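(* Let $\phi:\mathbb{R}\to\mathbb{R}^2$ be $\phi(x)=(1,x)$ and let $Z=(X_1,X_2)=\int_0^1\phi(z)\,\mathrm{d}\mathcal{L}(z)$ be the stochastic integral of $\phi$ with respect to Cauchy motion. For $x_1\neq 2x_2$ the density function of $Z$ is $$f(x_1,x_2)=\frac{4/\pi^2}{1+6x_1^2+x_1^4-16x_1x_2+16x_2^2}+\frac{2}{\pi^2}\,\Re\!\left(\frac{\mathrm{atan}\big(iQ/(x_1-2x_2)\big)}{Q^{3/2}}\right),$$ where $Q=1-2ix_1+x_1^2+4ix_2$. For $x_1=2x_2$ the density is $$f(x_1,x_2)=\frac{4/\pi^2}{(1+x_1^2)^2}+\frac{1}{\pi(1+x_1^2)^{3/2}}.$$
   Context: Cauchy motion is a stochastic process $\{X(t):t\in\mathbb{R}\}$ with $X(0)=0$, independent increments, and $X(t)-X(s)$ distributed as the Cauchy distribution $C(0,|t-s|)$ (density $\frac{R}{\pi(R^2+x^2)}$ for $C(0,R)$). For a (Riemann) integrable deterministic $\phi=(\phi_1,\dots,\phi_d):\mathbb{R}\to\mathbb{R}^d$, the stochastic integral $\int_a^b\phi(x)\,\mathrm{d}\mathcal{L}(x)$ is the random vector in $\mathbb{R}^d$ whose characteristic function is $(c_1,\dots,c_d)\mapsto\exp\big(-\int_a^b|c_1\phi_1(x)+\dots+c_d\phi_d(x)|\,\mathrm{d}x\big)$. $\Re$ denotes the real part. Complex functions use standard principal branches: $\ln$ of $e^t(\cos\alpha+i\sin\alpha)$ with $\alpha\in(-\pi,\pi]$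 is $t+i\alpha$; $\mathrm{atan}(z)=\frac{i}{2}(\ln(1-iz)-\ln(1+iz))$ for $z\ne\pm i$; $Q^{3/2}$ uses the principal branch.
   Formalization: For x1≠2x2 the formal formula has atan(i√Q/(x1−2x2)), with the principal root, in place of atan(iQ/(x1−2x2)); the printed expression is negative near (0,10), so it cannot be a density. *)

theory Defs
  imports "HOL-Probability.Probability"
begin

definition vec_char :: "'a::euclidean_space measure \<Rightarrow> 'a \<Rightarrow> complex" where
  "vec_char \<mu> c = (CLINT x|\<mu>. iexp (c \<bullet> x))"

lemma vec_char_real: "vec_char (\<mu> :: real measure) = char \<mu>"
  by (simp add: fun_eq_iff vec_char_def char_def)

(* Z is (a version of) the integral of \<phi> over [a,b] with respect to Cauchy motion.  For
   deterministic \<phi> this integral is defined through its law, by the characteristic function,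
   so the driving process itself is not a parameter.  Absolute integrability covers every
   Riemann integrable \<phi>, and makes all the integrals on the right-hand side exist. *)
definition cauchy_stochastic_integral ::
    "'w measure \<Rightarrow> real \<Rightarrow> real \<Rightarrow> (real \<Rightarrow> 'a::euclidean_space) \<Rightarrow> ('w \<Rightarrow> 'a) \<Rightarrow> bool" where
  "cauchy_stochastic_integral M a b \<phi> Z \<longleftrightarrow>
     \<phi> absolutely_integrable_on {a..b} \<and>
     Z \<in> borel_measurable M \<and>
     (\<forall>c. vec_char (distr M borel Z) c
            = complex_of_real (exp (- integral {a..b} (\<lambda>x. \<bar>c \<bullet> \<phi> x\<bar>))))"

(* A density is only determined almost everywhere.  To speak of its value at a given point (e.g.
   on a line in the plane) we take the continuous version, which is unique if it exists. *)
definition continuous_density ::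
    "'w measure \<Rightarrow> ('w \<Rightarrow> 'a::euclidean_space) \<Rightarrow> ('a \<Rightarrow> real) \<Rightarrow> bool" where
  "continuous_density M Z f \<longleftrightarrow>
     continuous_on UNIV f \<and> (\<forall>x. 0 \<le> f x) \<and> distributed M lborel Z (\<lambda>x. ennreal (f x))"

(* Pitfall: the density is sometimes printed with atan (i Q / (x1 - 2 x2)), without the root on Q.
   That expression is negative at x = (0, 10), hence not a density; the argument has to be
   i sqrt Q / (x1 - 2 x2).  Since Re Q = 1 + x1^2 > 0, the root stays off its branch cut.

   The library's Arctan differs from the following on the branch cut {i y | y > 1}. *)
definition atan :: "complex \<Rightarrow> complex" where
  "atan z = \<i> / 2 * (Ln (1 - \<i> * z) - Ln (1 + \<i> * z))"

end

theory Submission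
  imports Defs "HOL-Real_Asymp.Real_Asymp"
begin

text \<open>
  The characteristic function \<open>exp (- g c)\<close>, with \<open>g c\<close> the integral of \<open>\<bar>c \<bullet> (1, x)\<bar>\<close> over the unit
  interval, is integrable, so Fourier inversion yields a continuous density; inversion itself is
  obtained by smoothing with a Gaussian kernel of vanishing width. In the coordinates \<open>c = (- s t, s)\<close> one has
  \<open>g c = \<bar>s\<bar> * k t\<close> with \<open>k t\<close> the mean distance of \<open>t\<close> from the unit interval. The integral over
  \<open>s\<close> is then a Laplace transform, which leaves the integral over the real line of
  the real part of \<open>1 / (k t + \<i> (t x1 - x2))\<^sup>2\<close>. As \<open>k\<close> is affine outside the unit interval and
  quadratic inside it, this integral is elementary; the discriminant of the quadratic piece is
  \<open>- Q\<close> up to conjugation, and the two arc tangents at its ends combine to a single one.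
\<close>

section \<open>Fourier inversion on Euclidean spaces\<close>

text \<open>Positivity of \<open>mean_dist\<close> does most of the work: it makes the Laplace
  transform converge, keeps the complex quadratic away from zero and, together with
  \<open>Re Q = 1 + x1^2 > 0\<close>, keeps both arc tangents off their branch cut. The delicate
  point is the combination of these arc tangents. Tangent identities determine their difference only
  modulo pi, so its real part is confined to an interval short enough to leave one candidate. For
  arguments \<open>p\<close> and \<open>q\<close> the addition formula degenerates when
  \<open>1 + p * q = 0\<close>, which happens precisely when \<open>Q\<close> is real, that is, on
  the line \<open>x1 = 2 * x2\<close>; there the difference is pi / 2. Both closed forms are thus
  evaluations of one integral that is valid at every point. Continuity across the line comes from
  the inversion formula and is never read off the closed forms.\<close>

lemma CLINT_iexp_gaussian:
  fixes \<sigma> z :: real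
  assumes "0 < \<sigma>"
  shows "(CLINT t|lborel. iexp (t * z) * exp (- (\<sigma>^2) * t^2 / 2)) = 2 * pi * normal_density 0 \<sigma> z"
    and "integrable lborel (\<lambda>t. exp (- (\<sigma>^2) * t^2 / 2))"
proof -
  \<comment> \<open>The summand 0 matches the shape of the affine substitution rule. Rescaling by
    \<open>inverse \<sigma>\<close> turns the weight into the standard normal density, whose
    characteristic function is known.\<close>
  have eq: "exp (- (\<sigma>^2) * (0 + inverse \<sigma> * t)^2 / 2) = sqrt (2 * pi) * std_normal_density t" for t
    using assms by (simp add: std_normal_density_def power_mult_distrib field_simps)
  have "integrable lborel (\<lambda>t. exp (- (\<sigma>^2) * (0 + inverse \<sigma> * t)^2 / 2))"
    unfolding eq by (intro integrable_mult_right integrable_normal_density) auto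
  then show "integrable lborel (\<lambda>t. exp (- (\<sigma>^2) * t^2 / 2))"
    using lborel_integrable_real_affine_iff[of "inverse \<sigma>" "\<lambda>t. exp (- (\<sigma>^2) * t^2 / 2)" 0] assms by simp
  have "(CLINT t|lborel. iexp (t * z) * exp (- (\<sigma>^2) * t^2 / 2))
      = (1 / \<sigma>) *\<^sub>R (CLINT t|lborel. iexp ((0 + inverse \<sigma> * t) * z) * exp (- (\<sigma>^2) * (0 + inverse \<sigma> * t)^2 / 2))"
    using assms by (subst lborel_integral_real_affine[of "inverse \<sigma>" _ 0]) (auto simp: field_simps)
  also have "\<dots> = (sqrt (2 * pi) / \<sigma>) * (CLINT t|lborel. std_normal_density t *\<^sub>R iexp (z / \<sigma> * t))"
    unfolding eq
    by (simp add: scaleR_conv_of_real mult_ac divide_inverse flip: integral_mult_right_zero)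
  also have "(CLINT t|lborel. std_normal_density t *\<^sub>R iexp (z / \<sigma> * t)) = char std_normal_distribution (z / \<sigma>)"
    unfolding char_def by (subst integral_density) auto
  also have "\<dots> = exp (- ((z / \<sigma>)^2) / 2)"
    by (simp add: char_std_normal_distribution)
  also have "(sqrt (2 * pi) / \<sigma>) * complex_of_real (exp (- ((z / \<sigma>)^2) / 2)) = 2 * pi * normal_density 0 \<sigma> z"
  proof -
    have "(sqrt (2 * pi) / \<sigma>) * exp (- ((z / \<sigma>)^2) / 2) = 2 * pi * normal_density 0 \<sigma> z"
      using assms by (simp add: normal_density_def real_sqrt_mult power_divide field_simps)
    then show ?thesis unfolding of_real_mult[symmetric] of_real_divide[symmetric] by simp
  qed
  finally show "(CLINT t|lborel. iexp (t * z) * exp (- (\<sigma>^2) * t^2 / 2)) = 2 * pi * normal_density 0 \<sigma> z" .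
qed

text \<open>For positive \<open>\<sigma>\<close>, the density of the centred normal law with
  covariance \<open>\<sigma>^2\<close> times the identity. The product over coordinates lets
  integrals factor into one-dimensional ones.\<close>

definition gaussian_kernel :: "real \<Rightarrow> 'a::euclidean_space \<Rightarrow> real" where
  "gaussian_kernel \<sigma> x = (\<Prod>b\<in>Basis. normal_density 0 \<sigma> (x \<bullet> b))"

lemma gaussian_kernel_nonneg [simp]: "0 \<le> gaussian_kernel \<sigma> x"
  by (auto simp: gaussian_kernel_def intro!: prod_nonneg)

lemma gaussian_kernel_measurable [measurable]: "gaussian_kernel \<sigma> \<in> borel_measurable borel"
  unfolding gaussian_kernel_def[abs_def] by measurable

lemma gaussian_kernel_minus: "gaussian_kernel \<sigma> (- x) = gaussian_kernel \<sigma> x"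
  by (simp add: gaussian_kernel_def normal_density_def)

text \<open>The power of \<open>\<sigma>\<close> is the Jacobian of
  \<open>x = \<sigma> *\<^sub>R z\<close>. After this substitution the weight is the same for all
  widths, as dominated convergence requires.\<close>

lemma gaussian_kernel_scale:
  fixes z :: "'a::euclidean_space"
  assumes "0 < \<sigma>"
  shows "\<sigma> ^ DIM('a) * gaussian_kernel \<sigma> (\<sigma> *\<^sub>R z) = gaussian_kernel 1 z"
proof -
  have "\<sigma> * normal_density 0 \<sigma> (\<sigma> * t) = std_normal_density t" for t
    using assms by (simp add: normal_density_def real_sqrt_mult power_mult_distrib)
  then show ?thesis
    by (simp add: gaussian_kernel_def flip: prod.distrib prod_constant)
qed

lemma nn_integral_gaussian_kernel:
  assumes "0 < \<sigma>"
  shows "(\<integral>\<^sup>+x. gaussian_kernel \<sigma> (x :: 'a::euclidean_space) \<partial>lborel) = 1"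
proof -
  have 1: "(\<integral>\<^sup>+x. normal_density 0 \<sigma> x \<partial>lborel) = 1"
    using assms by (subst nn_integral_eq_integral) auto
  have "(\<integral>\<^sup>+x. gaussian_kernel \<sigma> (x :: 'a) \<partial>lborel) = (\<integral>\<^sup>+x. (\<Prod>b\<in>Basis. ennreal (normal_density 0 \<sigma> ((x :: 'a) \<bullet> b))) \<partial>lborel)"
    unfolding gaussian_kernel_def by (intro nn_integral_cong) (simp add: prod_ennreal)
  also have "\<dots> = 1"
    by (subst nn_integral_lborel_prod) (auto simp: 1)
  finally show ?thesis .
qed

text \<open>Since \<open>c \<bullet> z\<close> and \<open>c \<bullet> c\<close> are sums over the
  basis, the integrand is a product of one-variable functions, and Lebesgue measure is the image of
  a product measure.\<close>

lemma CLINT_iexp_gaussian_kernel: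
  fixes z :: "'a::euclidean_space"
  assumes "0 < \<sigma>"
  shows "(CLINT c|lborel. iexp (c \<bullet> z) * exp (- (\<sigma>^2) * (c \<bullet> c) / 2)) = (2 * pi) ^ DIM('a) * gaussian_kernel \<sigma> z"
    and "integrable lborel (\<lambda>c::'a. exp (- (\<sigma>^2) * (c \<bullet> c) / 2))"
proof -
  interpret product_sigma_finite "\<lambda>b::'a. lborel :: real measure" ..
  \<comment> \<open>\<open>?S\<close> assembles a vector from its coordinates; it is the map under
    which \<open>lborel\<close> is the image of the product of real Lebesgue measures.\<close>
  let ?S = "\<lambda>f. \<Sum>b\<in>Basis. f b *\<^sub>R (b::'a)"
  have sq: "?S f \<bullet> ?S f = (\<Sum>b\<in>Basis. (f b)^2)" for f
    by (subst euclidean_inner) (simp add: power2_eq_square)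
  have ex: "exp (- (\<sigma>^2) * (?S f \<bullet> ?S f) / 2) = (\<Prod>b\<in>Basis. exp (- (\<sigma>^2) * (f b)^2 / 2))" for f
    unfolding sq by (simp add: exp_sum[symmetric] sum_distrib_left sum_divide_distrib sum_negf)
  have ie: "iexp (?S f \<bullet> z) = (\<Prod>b\<in>Basis. iexp (f b * (z \<bullet> b)))" for f
    by (simp add: exp_sum[symmetric] sum_distrib_left inner_sum_right inner_commute[of _ z])
  show "integrable lborel (\<lambda>c::'a. exp (- (\<sigma>^2) * (c \<bullet> c) / 2))"
    by (subst lborel_eq, subst integrable_distr_eq)
       (auto simp only: ex finite_Basis intro!: product_integrable_prod CLINT_iexp_gaussian(2) assms, measurable)
  have "(CLINT c|lborel. iexp (c \<bullet> z) * exp (- (\<sigma>^2) * (c \<bullet> c) / 2)) =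
     (CLINT f|(\<Pi>\<^sub>M b\<in>Basis. lborel). (\<Prod>b\<in>Basis. iexp (f b * (z \<bullet> b)) * exp (- (\<sigma>^2) * (f b)^2 / 2)))"
    by (subst lborel_eq, subst integral_distr)
       (auto simp only: ex ie prod.distrib of_real_prod, measurable)
  also have "\<dots> = (\<Prod>b\<in>Basis. (CLINT t|lborel. iexp (t * (z \<bullet> b)) * exp (- (\<sigma>^2) * t^2 / 2)))"
  proof (rule product_integral_prod)
    fix b :: 'a
    show "integrable lborel (\<lambda>t. iexp (t * (z \<bullet> b)) * exp (- (\<sigma>^2) * t^2 / 2))"
      by (rule Bochner_Integration.integrable_bound[OF CLINT_iexp_gaussian(2)[OF assms]]) (auto simp: norm_mult)
  qed simp
  also have "\<dots> = (2 * pi) ^ DIM('a) * gaussian_kernel \<sigma> z"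
    by (simp only: CLINT_iexp_gaussian(1)[OF assms])
       (simp add: gaussian_kernel_def prod.distrib power_mult_distrib)
  finally show "(CLINT c|lborel. iexp (c \<bullet> z) * exp (- (\<sigma>^2) * (c \<bullet> c) / 2)) = (2 * pi) ^ DIM('a) * gaussian_kernel \<sigma> z" .
qed

section \<open>Smoothing a probability measure with the Gaussian kernel\<close>

lemma borel_measurable_vec_char:
  assumes "prob_space \<mu>" and [measurable_cong]: "sets \<mu> = sets borel"
  shows "vec_char \<mu> \<in> borel_measurable borel"
proof -
  interpret prob_space \<mu> by fact
  show ?thesis
    unfolding vec_char_def[abs_def] by (rule borel_measurable_lebesgue_integral) measurable
qed

lemma gaussian_kernel_le:
  fixes x :: "'a::euclidean_space"
  shows "gaussian_kernel \<sigma> x \<le> (1 / sqrt (2 * pi * \<sigma>^2)) ^ DIM('a)"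
proof -
  have "gaussian_kernel \<sigma> x \<le> (\<Prod>b\<in>(Basis::'a set). 1 / sqrt (2 * pi * \<sigma>^2))"
    unfolding gaussian_kernel_def
    by (intro prod_mono) (auto simp: normal_density_def divide_right_mono)
  then show ?thesis by simp
qed

lemma nn_integral_lborel_affine:
  fixes t :: "'a::euclidean_space"
  assumes [measurable]: "f \<in> borel_measurable borel" and "c \<noteq> 0"
  shows "(\<integral>\<^sup>+x. f x \<partial>lborel) = (\<integral>\<^sup>+x. ennreal (\<bar>c\<bar> ^ DIM('a)) * f (t + c *\<^sub>R x) \<partial>lborel)"
  by (subst lborel_affine[OF \<open>c \<noteq> 0\<close>, of t]) (simp add: nn_integral_density nn_integral_distr)

text \<open>Write the kernel as the Fourier transform of a Gaussian and exchange the integrals. The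
  Gaussian factor alone justifies Fubini, whether or not the characteristic function is integrable.
  The right-hand integral is the density of \<open>\<mu>\<close> convolved with the normal
  law.\<close>

lemma gaussian_smoothing_fourier:
  fixes \<mu> :: "'a::euclidean_space measure"
  assumes "prob_space \<mu>" and [measurable_cong]: "sets \<mu> = sets borel" and "0 < \<sigma>"
  shows "(CLINT c|lborel. iexp (- (c \<bullet> x)) * vec_char \<mu> c * exp (- (\<sigma>^2) * (c \<bullet> c) / 2))
      = (2 * pi) ^ DIM('a) * (LINT y|\<mu>. gaussian_kernel \<sigma> (x - y))"
proof -
  interpret prob_space \<mu> by fact
  interpret pair_sigma_finite lborel \<mu> ..
  let ?e = "\<lambda>c::'a. exp (- (\<sigma>^2) * (c \<bullet> c) / 2)"
  let ?F = "\<lambda>c y. iexp (c \<bullet> (y - x)) * ?e c"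
  note e = CLINT_iexp_gaussian_kernel[OF \<open>0 < \<sigma>\<close>]
  have int: "integrable (lborel \<Otimes>\<^sub>M \<mu>) (\<lambda>(c, y). ?F c y)"
  proof (rule Fubini_integrable)
    show "integrable lborel (\<lambda>c. LINT y|\<mu>. norm (case (c, y) of (c, y) \<Rightarrow> ?F c y))"
      using e(2) by (simp add: norm_mult prob_space)
    show "AE c in lborel. integrable \<mu> (\<lambda>y. case (c, y) of (c, y) \<Rightarrow> ?F c y)"
    proof (intro AE_I2)
      fix c show "integrable \<mu> (\<lambda>y. case (c, y) of (c, y) \<Rightarrow> ?F c y)"
        by (rule integrable_const_bound[where B = "?e c"]) (auto simp: norm_mult)
    qed
  qed measurable
  have "(CLINT c|lborel. iexp (- (c \<bullet> x)) * vec_char \<mu> c * ?e c) = (CLINT c|lborel. CLINT y|\<mu>. ?F c y)"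
  proof (intro Bochner_Integration.integral_cong refl)
    fix c
    have "?F c y = (iexp (- (c \<bullet> x)) * ?e c) * iexp (c \<bullet> y)" for y
      by (simp add: inner_diff_right exp_diff exp_minus field_simps)
    then show "iexp (- (c \<bullet> x)) * vec_char \<mu> c * ?e c = (CLINT y|\<mu>. ?F c y)"
      unfolding vec_char_def by simp
  qed
  also have "\<dots> = (CLINT y|\<mu>. CLINT c|lborel. ?F c y)"
    using Fubini_integral[OF int] by simp
  also have "\<dots> = (CLINT y|\<mu>. complex_of_real ((2 * pi) ^ DIM('a) * gaussian_kernel \<sigma> (x - y)))"
    unfolding e(1) by (subst minus_diff_eq[symmetric], subst gaussian_kernel_minus) simp
  also have "\<dots> = (2 * pi) ^ DIM('a) * (LINT y|\<mu>. gaussian_kernel \<sigma> (x - y))"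
    unfolding integral_complex_of_real by simp
  finally show ?thesis .
qed

text \<open>In probabilistic terms both sides are the expectation of
  \<open>\<phi> (Y + \<sigma> *\<^sub>R N)\<close> with \<open>Y\<close> of law \<open>\<mu>\<close>
  and \<open>N\<close> an independent standard normal vector: Tonelli, then
  \<open>x = y + \<sigma> *\<^sub>R z\<close>.\<close>

lemma nn_integral_gaussian_smoothing:
  fixes \<mu> :: "'a::euclidean_space measure" and \<phi> :: "'a \<Rightarrow> real"
  assumes "prob_space \<mu>" and [measurable_cong]: "sets \<mu> = sets borel" and "0 < \<sigma>"
    and [measurable]: "\<phi> \<in> borel_measurable borel" and \<phi>: "\<And>x. 0 \<le> \<phi> x"
  shows "(\<integral>\<^sup>+x. \<phi> x * (LINT y|\<mu>. gaussian_kernel \<sigma> (x - y)) \<partial>lborel)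
       = (\<integral>\<^sup>+y. \<integral>\<^sup>+z. \<phi> (y + \<sigma> *\<^sub>R z) * gaussian_kernel 1 z \<partial>lborel \<partial>\<mu>)"
proof -
  interpret prob_space \<mu> by fact
  interpret pair_sigma_finite lborel \<mu> ..
  have int: "integrable \<mu> (\<lambda>y. gaussian_kernel \<sigma> (x - y))" for x :: 'a
    by (rule integrable_const_bound[where B = "(1 / sqrt (2 * pi * \<sigma>^2)) ^ DIM('a)"]) (auto simp: gaussian_kernel_le)
  have "(\<integral>\<^sup>+x. \<phi> x * (LINT y|\<mu>. gaussian_kernel \<sigma> (x - y)) \<partial>lborel)
      = (\<integral>\<^sup>+x. \<integral>\<^sup>+y. ennreal (\<phi> x * gaussian_kernel \<sigma> (x - y)) \<partial>\<mu> \<partial>lborel)"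
    by (simp add: nn_integral_eq_integral int \<phi> ennreal_mult integral_nonneg_AE nn_integral_cmult)
  also have "\<dots> = (\<integral>\<^sup>+y. \<integral>\<^sup>+x. ennreal (\<phi> x * gaussian_kernel \<sigma> (x - y)) \<partial>lborel \<partial>\<mu>)"
    by (rule Fubini'[symmetric]) measurable
  also have "\<dots> = (\<integral>\<^sup>+y. \<integral>\<^sup>+z. \<phi> (y + \<sigma> *\<^sub>R z) * gaussian_kernel 1 z \<partial>lborel \<partial>\<mu>)"
  proof (rule nn_integral_cong)
    fix y
    have "(\<integral>\<^sup>+x. ennreal (\<phi> x * gaussian_kernel \<sigma> (x - y)) \<partial>lborel)
       = (\<integral>\<^sup>+z. ennreal (\<bar>\<sigma>\<bar> ^ DIM('a)) * ennreal (\<phi> (y + \<sigma> *\<^sub>R z) * gaussian_kernel \<sigma> (y + \<sigma> *\<^sub>R z - y)) \<partial>lborel)"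
      using \<open>0 < \<sigma>\<close> by (intro nn_integral_lborel_affine) auto
    also have "\<dots> = (\<integral>\<^sup>+z. \<phi> (y + \<sigma> *\<^sub>R z) * gaussian_kernel 1 z \<partial>lborel)"
      using \<open>0 < \<sigma>\<close> by (intro nn_integral_cong)
        (simp add: \<phi> ennreal_mult[symmetric] gaussian_kernel_scale[symmetric] mult_ac)
    finally show "(\<integral>\<^sup>+x. ennreal (\<phi> x * gaussian_kernel \<sigma> (x - y)) \<partial>lborel)
        = (\<integral>\<^sup>+z. \<phi> (y + \<sigma> *\<^sub>R z) * gaussian_kernel 1 z \<partial>lborel)" .
  qed
  finally show ?thesis .
qed

text \<open>Weak convergence of the smoothed laws to \<open>\<mu>\<close>. Continuity of
  \<open>\<phi>\<close> gives the pointwise limit; \<open>B\<close> times the unit kernel dominates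
  the inner integral, and the constant \<open>B\<close> the outer one.\<close>

lemma nn_integral_gaussian_smoothing_LIMSEQ:
  fixes \<mu> :: "'a::euclidean_space measure" and \<phi> :: "'a \<Rightarrow> real"
  assumes "prob_space \<mu>" and [measurable_cong]: "sets \<mu> = sets borel"
    and s: "\<And>n. 0 < s n" "s \<longlonglongrightarrow> 0"
    and cont: "continuous_on UNIV \<phi>" and \<phi>: "\<And>x. 0 \<le> \<phi> x" "\<And>x. \<phi> x \<le> B"
  shows "(\<lambda>n. \<integral>\<^sup>+x. \<phi> x * (LINT y|\<mu>. gaussian_kernel (s n) (x - y)) \<partial>lborel) \<longlonglongrightarrow> (\<integral>\<^sup>+y. \<phi> y \<partial>\<mu>)"
proof -
  interpret prob_space \<mu> by fact
  have [measurable]: "\<phi> \<in> borel_measurable borel"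
    using cont by (rule borel_measurable_continuous_onI)
  have inner: "(\<integral>\<^sup>+z. ennreal (C * gaussian_kernel 1 (z::'a)) \<partial>lborel) = C" if "0 \<le> C" for C
    using that by (simp add: ennreal_mult nn_integral_cmult nn_integral_gaussian_kernel)
  have B: "0 \<le> B" using order_trans[OF \<phi>(1) \<phi>(2)] .
  show ?thesis
    unfolding nn_integral_gaussian_smoothing[OF assms(1,2) s(1) \<open>\<phi> \<in> borel_measurable borel\<close> \<phi>(1)]
  proof (rule nn_integral_dominated_convergence[where w = "\<lambda>_. ennreal B"])
    show "AE y in \<mu>. (\<integral>\<^sup>+z. \<phi> (y + s n *\<^sub>R z) * gaussian_kernel 1 z \<partial>lborel) \<le> ennreal B" for n
      unfolding inner[OF B, symmetric]
      by (intro AE_I2 nn_integral_mono ennreal_leI mult_right_mono \<phi>) auto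
    show "AE y in \<mu>. (\<lambda>n. \<integral>\<^sup>+z. \<phi> (y + s n *\<^sub>R z) * gaussian_kernel 1 z \<partial>lborel) \<longlonglongrightarrow> ennreal (\<phi> y)"
    proof (intro AE_I2)
      fix y
      have "(\<lambda>n. \<integral>\<^sup>+z. \<phi> (y + s n *\<^sub>R z) * gaussian_kernel 1 z \<partial>lborel) \<longlonglongrightarrow> (\<integral>\<^sup>+z. \<phi> y * gaussian_kernel 1 (z::'a) \<partial>lborel)"
      proof (rule nn_integral_dominated_convergence[where w = "\<lambda>z. ennreal (B * gaussian_kernel 1 z)"])
        show "AE z::'a in lborel. ennreal (\<phi> (y + s n *\<^sub>R z) * gaussian_kernel 1 z) \<le> ennreal (B * gaussian_kernel 1 z)" for n
          by (intro AE_I2 ennreal_leI mult_right_mono \<phi>) auto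
        show "AE z::'a in lborel. (\<lambda>n. ennreal (\<phi> (y + s n *\<^sub>R z) * gaussian_kernel 1 z)) \<longlonglongrightarrow> ennreal (\<phi> y * gaussian_kernel 1 z)"
        proof (intro AE_I2 tendsto_ennrealI tendsto_mult_right)
          fix z
          have "(\<lambda>n. y + s n *\<^sub>R z) \<longlonglongrightarrow> y + 0 *\<^sub>R z"
            by (intro tendsto_intros s)
          then show "(\<lambda>n. \<phi> (y + s n *\<^sub>R z)) \<longlonglongrightarrow> \<phi> y"
            using continuous_on_tendsto_compose[OF cont] by fastforce
        qed
        show "(\<integral>\<^sup>+ z. ennreal (B * gaussian_kernel 1 (z::'a)) \<partial>lborel) < \<infinity>"
          using inner[OF B] by simp
      qed measurable
      then show "(\<lambda>n. \<integral>\<^sup>+z. \<phi> (y + s n *\<^sub>R z) * gaussian_kernel 1 z \<partial>lborel) \<longlonglongrightarrow> ennreal (\<phi> y)"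
        using inner[OF \<phi>(1)] by simp
    qed
    show "(\<integral>\<^sup>+ y. ennreal B \<partial>\<mu>) < \<infinity>"
      by (simp add: emeasure_space_1)
  qed measurable
qed

section \<open>Recognising a density from continuous test functions\<close>

lemma measure_eqI_box:
  fixes M N :: "'a::euclidean_space measure"
  assumes "sets M = sets borel" "sets N = sets borel"
    and eq: "\<And>a b. emeasure M (box a b) = emeasure N (box a b)"
    and fin: "\<And>a b. emeasure M (box a b) \<noteq> \<infinity>"
  shows "M = N"
proof (rule measure_eqI_generator_eq)
  let ?E = "range (\<lambda>(a, b). box a b :: 'a set)"
  let ?A = "\<lambda>n::nat. box (- (real n *\<^sub>R One)) (real n *\<^sub>R One) :: 'a set"
  show "Int_stable ?E"
    by (auto simp: Int_stable_def box_Int_box)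
  show "?E \<subseteq> Pow UNIV" "sets M = sigma_sets UNIV ?E" "sets N = sigma_sets UNIV ?E"
    by (simp_all add: borel_eq_box assms)
  show "range ?A \<subseteq> ?E" "(\<Union>i. ?A i) = UNIV"
    unfolding UN_box_eq_UNIV by auto
  show "emeasure M (?A i) \<noteq> \<infinity>" for i
    by (rule fin)
  show "emeasure M X = emeasure N X" if "X \<in> ?E" for X
    using that eq by auto
qed

text \<open>The witnesses are multiples of the distance to the complement of the box, cut off at 1.
  That distance is positive exactly on the box because the box is open.\<close>

lemma continuous_approx_indicator_box:
  fixes a b :: "'a::euclidean_space"
  obtains \<phi> :: "nat \<Rightarrow> 'a \<Rightarrow> real" where
    "\<And>k. continuous_on UNIV (\<phi> k)" "\<And>k x. 0 \<le> \<phi> k x" "\<And>k x. \<phi> k x \<le> indicator (box a b) x"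
    "\<And>x. (\<lambda>k. \<phi> k x) \<longlonglongrightarrow> indicator (box a b) x"
proof -
  let ?d = "\<lambda>x. infdist x (- box a b)"
  \<comment> \<open>Distance to the empty set is 0 by convention, which would spoil positivity
    inside the box; boundedness of the box rules this out.\<close>
  have ne: "- box a b \<noteq> {}"
    using bounded_box[of a b] not_bounded_UNIV by (metis double_compl Compl_empty_eq)
  have out: "?d x = 0" if "x \<notin> box a b" for x
    using that by simp
  have pos: "0 < ?d x" if "x \<in> box a b" for x
    using that ne in_closed_iff_infdist_zero[of "- box a b" x] infdist_nonneg[of x "- box a b"]
    by (auto simp: closed_def less_le)
  show ?thesis
  proof (rule that[of "\<lambda>k x. min 1 (real k * ?d x)"])
    show "continuous_on UNIV (\<lambda>x. min 1 (real k * ?d x))" for k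
      by (intro continuous_intros)
    show "0 \<le> min 1 (real k * ?d x)" for k x
      by (simp add: infdist_nonneg)
    show "min 1 (real k * ?d x) \<le> indicator (box a b) x" for k x
      using out[of x] by (auto simp: indicator_def)
    show "(\<lambda>k. min 1 (real k * ?d x)) \<longlonglongrightarrow> indicator (box a b) x" for x
    proof (cases "x \<in> box a b")
      case True
      obtain K :: nat where K: "1 < real K * ?d x"
        using reals_Archimedean3[OF pos[OF True]] by blast
      have "min 1 (real k * ?d x) = 1" if "K \<le> k" for k
      proof -
        have "real K * ?d x \<le> real k * ?d x"
          using that by (intro mult_right_mono) (auto simp: infdist_nonneg)
        then show ?thesis using K by simp
      qed
      then have "eventually (\<lambda>k. min 1 (real k * ?d x) = 1) sequentially"
        by (auto simp: eventually_sequentially)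
      then show ?thesis
        using True by (simp add: tendsto_eventually)
    qed (simp add: out)
  qed
qed

text \<open>Both sides of \<open>test\<close> pass to the limit along continuous approximations of a
  box indicator from below. The dominating functions are the indicator under \<open>\<mu>\<close>
  and \<open>B\<close> times the indicator under Lebesgue measure, which is where the bound on
  \<open>f\<close> enters.\<close>

lemma measure_eq_density_testI:
  fixes \<mu> :: "'a::euclidean_space measure" and f :: "'a \<Rightarrow> real"
  assumes "prob_space \<mu>" and [measurable_cong]: "sets \<mu> = sets borel"
    and [measurable]: "f \<in> borel_measurable borel" and f: "\<And>x. 0 \<le> f x" "\<And>x. f x \<le> B"
    and test: "\<And>\<phi> a b. continuous_on UNIV \<phi> \<Longrightarrow> (\<And>x. 0 \<le> \<phi> x) \<Longrightarrow> (\<And>x. \<phi> x \<le> indicator (box a b) x)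
        \<Longrightarrow> (\<integral>\<^sup>+x. ennreal (\<phi> x * f x) \<partial>lborel) = (\<integral>\<^sup>+x. ennreal (\<phi> x) \<partial>\<mu>)"
  shows "\<mu> = density lborel (\<lambda>x. ennreal (f x))"
proof (rule measure_eqI_box)
  interpret prob_space \<mu> by fact
  fix a b :: 'a
  obtain \<phi> :: "nat \<Rightarrow> 'a \<Rightarrow> real" where \<phi>: "\<And>k. continuous_on UNIV (\<phi> k)" "\<And>k x. 0 \<le> \<phi> k x"
    "\<And>k x. \<phi> k x \<le> indicator (box a b) x" "\<And>x. (\<lambda>k. \<phi> k x) \<longlonglongrightarrow> indicator (box a b) x"
    by (rule continuous_approx_indicator_box[of a b]) blast
  have [measurable]: "\<phi> k \<in> borel_measurable borel" for k
    using \<phi>(1) by (rule borel_measurable_continuous_onI)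
  have "(\<lambda>k. \<integral>\<^sup>+x. ennreal (\<phi> k x) \<partial>\<mu>) \<longlonglongrightarrow> (\<integral>\<^sup>+x. ennreal (indicator (box a b) x) \<partial>\<mu>)"
  proof (rule nn_integral_dominated_convergence[where w = "\<lambda>x. ennreal (indicator (box a b) x)"])
    show "(\<integral>\<^sup>+x. ennreal (indicator (box a b) x) \<partial>\<mu>) < \<infinity>"
      by (simp add: ennreal_indicator emeasure_eq_measure)
  qed (auto intro!: AE_I2 ennreal_leI \<phi> tendsto_ennrealI)
  moreover have "(\<lambda>k. \<integral>\<^sup>+x. ennreal (\<phi> k x * f x) \<partial>lborel) \<longlonglongrightarrow> (\<integral>\<^sup>+x. ennreal (indicator (box a b) x * f x) \<partial>lborel)"
  proof (rule nn_integral_dominated_convergence[where w = "\<lambda>x. ennreal (indicator (box a b) x * B)"])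
    have "(\<integral>\<^sup>+x. ennreal (indicator (box a b) x * B) \<partial>lborel) = ennreal B * emeasure lborel (box a b)"
      using order_trans[OF f] by (simp add: ennreal_mult ennreal_indicator nn_integral_multc mult.commute[of "ennreal B"])
    then show "(\<integral>\<^sup>+x. ennreal (indicator (box a b) x * B) \<partial>lborel) < \<infinity>"
      using emeasure_lborel_box_finite[of a b] by (simp add: ennreal_mult_less_top)
    show "AE x in lborel. ennreal (\<phi> k x * f x) \<le> ennreal (indicator (box a b) x * B)" for k
      by (intro AE_I2 ennreal_leI mult_mono \<phi> f) auto
  qed (auto intro!: AE_I2 ennreal_leI \<phi> tendsto_ennrealI tendsto_intros)
  ultimately have "(\<integral>\<^sup>+x. ennreal (indicator (box a b) x) \<partial>\<mu>) = (\<integral>\<^sup>+x. ennreal (indicator (box a b) x * f x) \<partial>lborel)"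
    using test[OF \<phi>(1-3)] by (auto intro: LIMSEQ_unique)
  then show "emeasure \<mu> (box a b) = emeasure (density lborel (\<lambda>x. ennreal (f x))) (box a b)"
    by (simp add: emeasure_density nn_integral_set_ennreal ennreal_indicator mult.commute)
  show "emeasure \<mu> (box a b) \<noteq> \<infinity>"
    by (simp add: emeasure_eq_measure)
qed (simp_all add: assms)

text \<open>The smoothed density \<open>K n\<close> is seen in two ways. As a Fourier integral it is
  bounded by \<open>B\<close> and converges pointwise to \<open>f\<close>; as a convolution it is
  nonnegative and converges weakly to \<open>\<mu>\<close>. Comparing the two limits on test
  functions identifies \<open>f\<close> as the density.\<close>

lemma vec_char_inversion:
  fixes \<mu> :: "'a::euclidean_space measure"
  assumes prob: "prob_space \<mu>" and sets: "sets \<mu> = sets borel"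
    and int: "integrable lborel (vec_char \<mu>)"
  defines "f \<equiv> \<lambda>x. Re (CLINT c|lborel. iexp (- (c \<bullet> x)) * vec_char \<mu> c) / (2 * pi) ^ DIM('a)"
  shows "continuous_on UNIV f" and "0 \<le> f x" and "\<mu> = density lborel (\<lambda>x. ennreal (f x))"
proof -
  note [measurable] = borel_measurable_vec_char[OF prob sets]
  let ?p = "(2 * pi) ^ DIM('a)"
  let ?I = "LINT c|lborel. norm (vec_char \<mu> c)"
  define B where "B = ?I / ?p"
  define s where "s n = inverse (real (Suc n))" for n
  define K where "K n x = (LINT y|\<mu>. gaussian_kernel (s n) (x - y))" for n x
  have s: "0 < s n" "s \<longlonglongrightarrow> 0" for n
    unfolding s_def using LIMSEQ_inverse_real_of_nat by simp_all
  have K: "K n x = Re (CLINT c|lborel. iexp (- (c \<bullet> x)) * vec_char \<mu> c * exp (- ((s n)^2) * (c \<bullet> c) / 2)) / ?p" for n x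
    unfolding gaussian_smoothing_fourier[OF prob sets s(1)] K_def by (simp flip: of_real_power)
  have K_nonneg: "0 \<le> K n x" for n x
    unfolding K_def by (simp add: integral_nonneg_AE)
  have K_le: "K n x \<le> B" for n x
  proof -
    have "K n x \<le> norm (CLINT c|lborel. iexp (- (c \<bullet> x)) * vec_char \<mu> c * exp (- ((s n)^2) * (c \<bullet> c) / 2)) / ?p"
      unfolding K by (intro divide_right_mono complex_Re_le_cmod) auto
    also have "\<dots> \<le> ?I / ?p"
    proof (intro divide_right_mono Bochner_Integration.integral_norm_bound_integral integrable_norm int)
      show "integrable lborel (\<lambda>c. iexp (- (c \<bullet> x)) * vec_char \<mu> c * exp (- ((s n)^2) * (c \<bullet> c) / 2))"
        by (rule Bochner_Integration.integrable_bound[OF int]) (auto simp: norm_mult mult_left_le)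
    qed (auto simp: norm_mult mult_left_le)
    finally show ?thesis unfolding B_def .
  qed
  have K_lim: "(\<lambda>n. K n x) \<longlonglongrightarrow> f x" for x
    unfolding K f_def
  proof (rule tendsto_divide[OF tendsto_Re tendsto_const], rule integral_dominated_convergence[where w = "\<lambda>c. norm (vec_char \<mu> c)"], goal_cases)
    case 4
    show ?case
    proof (rule AE_I2)
      fix c :: 'a
      have "(\<lambda>n. iexp (- (c \<bullet> x)) * vec_char \<mu> c * exp (- ((s n)^2) * (c \<bullet> c) / 2))
          \<longlonglongrightarrow> iexp (- (c \<bullet> x)) * vec_char \<mu> c * exp (- (0^2) * (c \<bullet> c) / 2)"
        unfolding of_real_exp[symmetric] by (intro tendsto_intros s) simp
      then show "(\<lambda>n. iexp (- (c \<bullet> x)) * vec_char \<mu> c * exp (- ((s n)^2) * (c \<bullet> c) / 2))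
          \<longlonglongrightarrow> iexp (- (c \<bullet> x)) * vec_char \<mu> c"
        by simp
    qed
  qed (use int in \<open>auto simp: norm_mult mult_left_le\<close>)
  show f_nonneg: "0 \<le> f x" for x
    using K_lim by (rule LIMSEQ_le_const) (auto simp: K_nonneg)
  have f_le: "f x \<le> B" for x
    using K_lim by (rule LIMSEQ_le_const2) (use K_le in blast)
  show cont: "continuous_on UNIV f"
    unfolding continuous_on_sequentially f_def comp_def
  proof (intro allI ballI impI, rule tendsto_divide[OF tendsto_Re tendsto_const],
      rule integral_dominated_convergence[where w = "\<lambda>c. norm (vec_char \<mu> c)"], goal_cases)
    case (4 u x)
    then have u: "u \<longlonglongrightarrow> x" by simp
    show ?case
      by (intro AE_I2 tendsto_intros u)
  qed (use int in \<open>auto simp: norm_mult\<close>)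
  have [measurable]: "f \<in> borel_measurable borel"
    using cont by (rule borel_measurable_continuous_onI)
  have [measurable]: "K n \<in> borel_measurable borel" for n
  proof -
    interpret prob_space \<mu> by (rule prob)
    note sets[measurable_cong]
    show ?thesis
      unfolding K_def[abs_def] by (rule borel_measurable_lebesgue_integral) measurable
  qed
  show "\<mu> = density lborel (\<lambda>x. ennreal (f x))"
  proof (rule measure_eq_density_testI[OF prob sets _ f_nonneg f_le])
    fix \<phi> :: "'a \<Rightarrow> real" and a b
    assume \<phi>: "continuous_on UNIV \<phi>" "\<And>x. 0 \<le> \<phi> x" "\<And>x. \<phi> x \<le> indicator (box a b) x"
    then have [measurable]: "\<phi> \<in> borel_measurable borel"
      by (intro borel_measurable_continuous_onI)
    have le1: "\<phi> x \<le> 1" for x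
      using \<phi>(3) indicator_le_1 by (rule order_trans)
    have "(\<lambda>n. \<integral>\<^sup>+x. \<phi> x * K n x \<partial>lborel) \<longlonglongrightarrow> (\<integral>\<^sup>+y. \<phi> y \<partial>\<mu>)"
      unfolding K_def by (rule nn_integral_gaussian_smoothing_LIMSEQ[OF prob sets s \<phi>(1,2) le1])
    moreover have "(\<lambda>n. \<integral>\<^sup>+x. \<phi> x * K n x \<partial>lborel) \<longlonglongrightarrow> (\<integral>\<^sup>+x. \<phi> x * f x \<partial>lborel)"
    \<comment> \<open>The test function lives on a box of finite volume, so the uniform bound
      \<open>B\<close> on \<open>K n\<close> is an integrable majorant there.\<close>
    proof (rule nn_integral_dominated_convergence[where w = "\<lambda>x. ennreal (indicator (box a b) x * B)"])
      have "(\<integral>\<^sup>+x. ennreal (indicator (box a b) x * B) \<partial>lborel) = ennreal B * emeasure lborel (box a b)"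
        using order_trans[OF f_nonneg f_le]
        by (simp add: ennreal_mult ennreal_indicator nn_integral_multc mult.commute[of "ennreal B"])
      then show "(\<integral>\<^sup>+x. ennreal (indicator (box a b) x * B) \<partial>lborel) < \<infinity>"
        using emeasure_lborel_box_finite[of a b] by (simp add: ennreal_mult_less_top)
      show "AE x in lborel. ennreal (\<phi> x * K n x) \<le> ennreal (indicator (box a b) x * B)" for n
        by (intro AE_I2 ennreal_leI mult_mono \<phi> K_le K_nonneg) auto
      show "AE x in lborel. (\<lambda>n. ennreal (\<phi> x * K n x)) \<longlonglongrightarrow> ennreal (\<phi> x * f x)"
        by (intro AE_I2 tendsto_ennrealI tendsto_intros K_lim)
    qed measurable
    ultimately show "(\<integral>\<^sup>+x. ennreal (\<phi> x * f x) \<partial>lborel) = (\<integral>\<^sup>+x. ennreal (\<phi> x) \<partial>\<mu>)"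
      by (rule LIMSEQ_unique[rotated])
  qed measurable
qed

section \<open>The Fourier integral in the plane\<close>

text \<open>With the second coordinate \<open>s\<close> fixed, only \<open>r = - (s * t)\<close> is
  substituted, an affine map with Jacobian \<open>\<bar>s\<bar>\<close>. It fails only for
  \<open>s = 0\<close>, a null set, so Tonelli replaces a two-dimensional substitution
  theorem.\<close>

lemma lborel_pair_change_of_variables:
  "(lborel :: (real \<times> real) measure) = distr (density lborel (\<lambda>p. ennreal \<bar>snd p\<bar>)) borel (\<lambda>p. (- (snd p * fst p), snd p))"
  (is "_ = distr ?D borel ?T")
proof (rule measure_eqI)
  fix A :: "(real \<times> real) set"
  assume "A \<in> sets lborel"
  then have [measurable]: "A \<in> sets borel" by simp
  have [measurable]: "(\<lambda>p. (- (snd p * fst p), snd p)) \<in> (borel :: (real \<times> real) measure) \<rightarrow>\<^sub>M (borel :: (real \<times> real) measure)"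
    "snd \<in> borel_measurable (borel :: (real \<times> real) measure)"
    by (simp_all add: borel_prod[symmetric])
  have m: "(\<lambda>t. indicator A (t, s) :: ennreal) \<in> borel_measurable borel" for s
    by measurable
  have "emeasure lborel A = (\<integral>\<^sup>+s. \<integral>\<^sup>+r. indicator A (r, s) \<partial>lborel \<partial>lborel)"
    by (subst lborel_pair.nn_integral_snd) (auto simp: lborel_prod)
  also have "\<dots> = (\<integral>\<^sup>+s. \<integral>\<^sup>+t. ennreal \<bar>s\<bar> * indicator A (?T (t, s)) \<partial>lborel \<partial>lborel)"
  proof (rule nn_integral_cong_AE)
    have "AE s in lborel. s \<noteq> (0::real)"
      by (rule AE_lborel_singleton)
    then show "AE s in lborel. (\<integral>\<^sup>+r. indicator A (r, s) \<partial>lborel)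
        = (\<integral>\<^sup>+t. ennreal \<bar>s\<bar> * indicator A (?T (t, s)) \<partial>lborel)"
    proof eventually_elim
      case (elim s)
      then show ?case
        using nn_integral_real_affine[OF m, of "- s" s 0]
        by (simp add: nn_integral_cmult)
    qed
  qed
  also have "\<dots> = (\<integral>\<^sup>+p. (case p of (t, s) \<Rightarrow> ennreal \<bar>s\<bar> * indicator A (?T (t, s))) \<partial>lborel)"
    by (subst lborel_pair.nn_integral_snd[symmetric, unfolded lborel_prod]) (simp_all add: split_beta)
  also have "\<dots> = emeasure (distr ?D borel ?T) A"
    by (subst nn_integral_indicator[symmetric], simp)
       (simp add: nn_integral_distr nn_integral_density split_beta' del: nn_integral_indicator)
  finally show "emeasure lborel A = emeasure (distr ?D borel ?T) A" .
qed simp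

lemma
  fixes F :: "real \<times> real \<Rightarrow> 'b::{banach, second_countable_topology}"
  assumes [measurable]: "F \<in> borel_measurable borel"
  shows integrable_pair_change_of_variables:
      "integrable lborel F \<longleftrightarrow> integrable lborel (\<lambda>(t, s). \<bar>s\<bar> *\<^sub>R F (- (s * t), s))" (is ?A)
    and integral_pair_change_of_variables:
      "(LINT c|lborel. F c) = (LINT p|lborel. (case p of (t, s) \<Rightarrow> \<bar>s\<bar> *\<^sub>R F (- (s * t), s)))" (is ?B)
proof -
  have [measurable]: "(\<lambda>p. (- (snd p * fst p), snd p)) \<in> (borel :: (real \<times> real) measure) \<rightarrow>\<^sub>M (borel :: (real \<times> real) measure)"
    "snd \<in> borel_measurable (borel :: (real \<times> real) measure)"
    by (simp_all add: borel_prod[symmetric])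
  show ?A
    by (subst lborel_pair_change_of_variables)
       (simp add: integrable_distr_eq integrable_density split_beta')
  show ?B
    by (subst lborel_pair_change_of_variables)
       (simp add: integral_distr integral_density split_beta')
qed

section \<open>Laplace transforms with complex parameter\<close>

lemma has_bochner_integral_laplace:
  fixes z :: complex
  assumes "0 < Re z"
  shows "has_bochner_integral lborel (\<lambda>s. indicator {0<..} s *\<^sub>R (complex_of_real s * exp (- (complex_of_real s * z)))) (1 / z^2)"
proof -
  let ?k = "Re z"
  have z: "z \<noteq> 0" using assms by auto
  \<comment> \<open>Integrability is settled first for the real exponent \<open>Re z\<close>, where
    the nonnegative form of the fundamental theorem supplies it. It transfers because the complex
    exponential has modulus \<open>exp (- (s * Re z))\<close>. The value then follows from the same
    antiderivative with complex \<open>z\<close>.\<close>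
  have "set_integrable lborel (einterval 0 \<infinity>) (\<lambda>s. s * exp (- (s * ?k)))"
  proof (rule interval_integral_FTC_nonneg(1))
    show "((\<lambda>s. - (s / ?k + 1 / ?k^2) * exp (- (s * ?k))) has_real_derivative s * exp (- (s * ?k))) (at s)" for s
      using assms by (auto intro!: derivative_eq_intros simp: field_simps power2_eq_square)
    show "(((\<lambda>s. - (s / ?k + 1 / ?k^2) * exp (- (s * ?k))) \<circ> real_of_ereal) \<longlongrightarrow> - (1 / ?k^2)) (at_right 0)"
      unfolding zero_ereal_def ereal_tendsto_simps using assms by (auto intro!: tendsto_eq_intros)
    show "(((\<lambda>s. - (s / ?k + 1 / ?k^2) * exp (- (s * ?k))) \<circ> real_of_ereal) \<longlongrightarrow> 0) (at_left \<infinity>)"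
      unfolding ereal_tendsto_simps using assms by real_asymp
  qed (auto intro!: AE_I2)
  then have *: "integrable lborel (\<lambda>s. indicator {0<..} s *\<^sub>R (s * exp (- (s * ?k))))"
    by (simp add: set_integrable_def zero_ereal_def)
  have int: "set_integrable lborel (einterval 0 \<infinity>) (\<lambda>s. complex_of_real s * exp (- (complex_of_real s * z)))"
    unfolding set_integrable_def zero_ereal_def einterval_eq
    by (rule Bochner_Integration.integrable_bound[OF *]) (auto simp: norm_mult indicator_def)
  have "(CLBINT s=0..\<infinity>. complex_of_real s * exp (- (complex_of_real s * z))) = 0 - (- (1 / z^2))"
  proof (rule interval_integral_FTC_integrable[OF _ _ _ int])
    show "((\<lambda>s. - (complex_of_real s / z + 1 / z^2) * exp (- (complex_of_real s * z))) has_vector_derivative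
        complex_of_real s * exp (- (complex_of_real s * z))) (at s)" for s
    proof -
      have "((\<lambda>s. - (s / z + 1 / z^2) * exp (- (s * z))) has_field_derivative s * exp (- (s * z))) (at s)" for s
        using z by (auto intro!: derivative_eq_intros simp: field_simps power2_eq_square)
      then show ?thesis by (rule has_vector_derivative_real_field)
    qed
    show "(((\<lambda>s. - (complex_of_real s / z + 1 / z^2) * exp (- (complex_of_real s * z))) \<circ> real_of_ereal) \<longlongrightarrow> - (1 / z^2)) (at_right 0)"
      unfolding zero_ereal_def ereal_tendsto_simps using assms by (auto intro!: tendsto_eq_intros)
    have "((\<lambda>s. - (complex_of_real s / z + 1 / z^2) * exp (- (complex_of_real s * z))) \<longlongrightarrow> 0) at_top"
    proof (rule Lim_null_comparison)
      show "eventually (\<lambda>s. norm (- (complex_of_real s / z + 1 / z^2) * exp (- (complex_of_real s * z)))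
          \<le> (s / norm z + 1 / (norm z)^2) * exp (- (s * ?k))) at_top"
        using eventually_ge_at_top[of 0]
      proof eventually_elim
        case (elim s)
        then have "norm (complex_of_real s / z + 1 / z^2) \<le> s / norm z + 1 / (norm z)^2"
          by (intro order_trans[OF norm_triangle_ineq]) (simp add: norm_divide norm_power)
        moreover have "norm (exp (- (complex_of_real s * z))) = exp (- (s * ?k))"
          by simp
        ultimately show ?case
          unfolding norm_mult norm_minus_cancel by (metis mult_right_mono exp_ge_zero)
      qed
      show "((\<lambda>s. (s / norm z + 1 / (norm z)^2) * exp (- (s * ?k))) \<longlongrightarrow> 0) at_top"
        using assms z by real_asymp
    qed
    then show "(((\<lambda>s. - (complex_of_real s / z + 1 / z^2) * exp (- (complex_of_real s * z))) \<circ> real_of_ereal) \<longlongrightarrow> 0) (at_left \<infinity>)"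
      unfolding ereal_tendsto_simps .
  qed auto
  with int show ?thesis
    by (simp add: has_bochner_integral_iff set_integrable_def interval_lebesgue_integral_def
        set_lebesgue_integral_def zero_ereal_def)
qed

text \<open>The half-lines \<open>s > 0\<close> and \<open>s < 0\<close> contribute conjugate
  values, which add up to twice the real part.\<close>

lemma has_bochner_integral_laplace_two_sided:
  fixes k m :: real
  assumes "0 < k"
  shows "has_bochner_integral lborel (\<lambda>s. \<bar>s\<bar> *\<^sub>R (exp (- \<bar>s\<bar> * k) * iexp (s * m)))
     (of_real (2 * Re (1 / (k + \<i> * m)^2)))"
proof -
  let ?g = "\<lambda>z s. indicator {0<..} s *\<^sub>R (complex_of_real s * exp (- (complex_of_real s * z)))"
  have 1: "has_bochner_integral lborel (?g (k - \<i> * m)) (1 / (k - \<i> * m)^2)"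
    using assms by (intro has_bochner_integral_laplace) auto
  have "has_bochner_integral lborel (?g (k + \<i> * m)) (1 / (k + \<i> * m)^2)"
    using assms by (intro has_bochner_integral_laplace) auto
  then have 2: "has_bochner_integral lborel (\<lambda>s. ?g (k + \<i> * m) (- s)) (1 / (k + \<i> * m)^2)"
    using lborel_has_bochner_integral_real_affine_iff[of "-1" "?g (k + \<i> * m)" _ 0] by simp
  have "cnj (1 / (k + \<i> * m)^2) = 1 / (k - \<i> * m)^2"
    by simp
  then have "of_real (2 * Re (1 / (k + \<i> * m)^2)) = 1 / (k - \<i> * m)^2 + 1 / (k + \<i> * m)^2"
    by (metis add.commute complex_add_cnj)
  moreover have "\<bar>s\<bar> *\<^sub>R (exp (- \<bar>s\<bar> * k) * iexp (s * m)) = ?g (k - \<i> * m) s + ?g (k + \<i> * m) (- s)" for s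
    by (auto simp: indicator_def scaleR_conv_of_real algebra_simps simp flip: exp_of_real exp_add)
  ultimately show ?thesis
    using has_bochner_integral_add[OF 1 2] by simp
qed

section \<open>The mean distance from the unit interval\<close>

definition mean_dist :: "real \<Rightarrow> real" where
  "mean_dist t = ((1 - t) * \<bar>1 - t\<bar> + t * \<bar>t\<bar>) / 2"

text \<open>The function \<open>u * \<bar>u\<bar> / 2\<close> is an antiderivative of
  \<open>\<bar>u\<bar>\<close>; evaluating it at \<open>u = 1 - t\<close> and \<open>u = - t\<close>
  gives the case-free formula of \<open>mean_dist\<close>.\<close>

lemma has_integral_mean_dist: "((\<lambda>x. \<bar>x - t\<bar>) has_integral mean_dist t) {0..1}"
proof -
  let ?F = "\<lambda>x. (x - t) * \<bar>x - t\<bar> / 2"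
  have "((\<lambda>x. \<bar>x - t\<bar>) has_integral (?F 1 - ?F 0)) {0..1}"
  \<comment> \<open>Away from \<open>t\<close> the sign of \<open>x - t\<close> is locally constant;
    at the exceptional point only continuity is asked for.\<close>
  proof (rule fundamental_theorem_of_calculus_strong[of "{t}"])
    fix x assume "x \<in> {0..1} - {t}"
    then consider "t < x" | "x < t" by fastforce
    then have "(?F has_real_derivative \<bar>x - t\<bar>) (at x)"
    proof cases
      case 1
      have "((\<lambda>x. (x - t) * (x - t) / 2) has_real_derivative \<bar>x - t\<bar>) (at x)"
        using 1 by (auto intro!: derivative_eq_intros)
      then show ?thesis
        by (rule has_field_derivative_transform_within_open[of _ _ _ "{t<..}"]) (use 1 in auto)
    next
      case 2
      have "((\<lambda>x. (x - t) * (t - x) / 2) has_real_derivative \<bar>x - t\<bar>) (at x)"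
        using 2 by (auto intro!: derivative_eq_intros)
      then show ?thesis
        by (rule has_field_derivative_transform_within_open[of _ _ _ "{..<t}"]) (use 2 in auto)
    qed
    then show "(?F has_vector_derivative \<bar>x - t\<bar>) (at x)"
      by (rule has_real_derivative_iff_has_vector_derivative[THEN iffD1])
  qed (auto intro!: continuous_intros)
  moreover have "?F 1 - ?F 0 = mean_dist t"
    by (simp add: mean_dist_def field_simps)
  ultimately show ?thesis by simp
qed

lemma mean_dist_simps:
  "t \<le> 0 \<Longrightarrow> mean_dist t = 1 / 2 - t"
  "0 \<le> t \<Longrightarrow> t \<le> 1 \<Longrightarrow> mean_dist t = t\<^sup>2 - t + 1 / 2"
  "1 \<le> t \<Longrightarrow> mean_dist t = t - 1 / 2"
  by (auto simp: mean_dist_def abs_if field_simps power2_eq_square)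

text \<open>The minimum 1 / 4 is attained at the midpoint; the second bound says that a mean of
  \<open>\<bar>x - t\<bar>\<close> is at least the modulus of the mean of \<open>x - t\<close>. The
  first controls bounded \<open>t\<close>, the second the growth at infinity.\<close>

lemma mean_dist_lower: "1 / 4 \<le> mean_dist t" "\<bar>t - 1 / 2\<bar> \<le> mean_dist t"
proof -
  have *: "t\<^sup>2 - t + 1 / 2 = (t - 1 / 2)\<^sup>2 + 1 / 4" "t\<^sup>2 - t + 1 / 2 = (\<bar>t - 1 / 2\<bar> - 1 / 2)\<^sup>2 + \<bar>t - 1 / 2\<bar>"
    by (auto simp: power2_eq_square abs_if algebra_simps)
  consider "t \<le> 0" | "0 \<le> t" "t \<le> 1" | "1 \<le> t" by linarith
  then have "1 / 4 \<le> mean_dist t \<and> \<bar>t - 1 / 2\<bar> \<le> mean_dist t"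
  proof cases
    case 2
    then have "mean_dist t = t\<^sup>2 - t + 1 / 2" by (simp add: mean_dist_simps)
    then show ?thesis
      using * zero_le_power2[of "t - 1 / 2"] zero_le_power2[of "\<bar>t - 1 / 2\<bar> - 1 / 2"] by linarith
  qed (auto simp: mean_dist_simps)
  then show "1 / 4 \<le> mean_dist t" "\<bar>t - 1 / 2\<bar> \<le> mean_dist t"
    by auto
qed

lemma mean_dist_pos: "0 < mean_dist t"
  using mean_dist_lower(1)[of t] by linarith

lemma continuous_mean_dist: "continuous_on A mean_dist"
  unfolding mean_dist_def[abs_def] by (intro continuous_intros) auto

lemma borel_measurable_mean_dist [measurable]: "mean_dist \<in> borel_measurable borel"
  by (intro borel_measurable_continuous_onI continuous_mean_dist)

lemma integrable_inverse_mean_dist: "integrable lborel (\<lambda>t. 1 / (mean_dist t)\<^sup>2)"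
proof (rule Bochner_Integration.integrable_bound)
  show "integrable lborel (\<lambda>t::real. 26 * inverse (1 + t\<^sup>2))"
    using integrable_inverse_1_plus_square by (simp add: set_integrable_def einterval_def)
  have "1 / (mean_dist t)\<^sup>2 \<le> 26 * inverse (1 + t\<^sup>2)" for t
  proof -
    have "(t - 1 / 2)\<^sup>2 \<le> (mean_dist t)\<^sup>2" "(1 / 4)\<^sup>2 \<le> (mean_dist t)\<^sup>2"
      using mean_dist_lower[of t] power_mono[of "\<bar>t - 1 / 2\<bar>" "mean_dist t" 2] power_mono[of "1 / 4" "mean_dist t" 2]
      by simp_all
    moreover have "t\<^sup>2 \<le> 2 * (t - 1 / 2)\<^sup>2 + 1 / 2"
      using zero_le_power2[of "t - 1"] by (simp add: power2_eq_square algebra_simps)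
    \<comment> \<open>The constant is 26 = 2 + 24: \<open>1 + t^2\<close> is at most
      \<open>2 * (t - 1 / 2)^2 + 3 / 2\<close>, where the square costs 2 and 3 / 2 is 24 times
      \<open>(1 / 4)^2\<close>.\<close>
    ultimately have "1 + t\<^sup>2 \<le> 26 * (mean_dist t)\<^sup>2"
      by (simp add: power2_eq_square)
    then show ?thesis
      using mean_dist_pos[of t] by (simp add: field_simps add_pos_nonneg)
  qed
  then show "AE t in lborel. norm (1 / (mean_dist t)\<^sup>2) \<le> norm (26 * inverse (1 + t\<^sup>2))"
    by (auto simp: abs_of_nonneg)
qed measurable

lemma integral_abs_line:
  "integral {0..1} (\<lambda>x. \<bar>(- (s * t), s) \<bullet> (1, x)\<bar>) = \<bar>s\<bar> * mean_dist t"
proof -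
  have "\<bar>(- (s * t), s) \<bullet> (1, x)\<bar> = \<bar>s\<bar> * \<bar>x - t\<bar>" for x
    by (simp add: algebra_simps flip: abs_mult)
  moreover have "((\<lambda>x. \<bar>s\<bar> * \<bar>x - t\<bar>) has_integral \<bar>s\<bar> * mean_dist t) {0..1}"
    by (intro has_integral_mult_right has_integral_mean_dist)
  ultimately show ?thesis
    by (simp only: integral_unique)
qed

text \<open>Along each line through the origin the integrand decays exponentially with rate
  \<open>k t\<close>, so integrating over \<open>s\<close> first leaves an integrable function of
  \<open>t\<close>. The hypothesis on \<open>\<psi>\<close> leaves out the points
  \<open>(r, 0)\<close> with \<open>r\<close> nonzero, a null set.\<close>

lemma plane_fourier_integral:
  fixes \<psi> :: "real \<times> real \<Rightarrow> complex" and k :: "real \<Rightarrow> real" and x1 x2 :: real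
  assumes [measurable]: "\<psi> \<in> borel_measurable borel" "k \<in> borel_measurable borel"
    and \<psi>: "\<And>t s. \<psi> (- (s * t), s) = exp (- \<bar>s\<bar> * k t)"
    and k: "\<And>t. 0 < k t" "integrable lborel (\<lambda>t. 1 / (k t)\<^sup>2)"
  shows "integrable lborel \<psi>"
    and "(CLINT c|lborel. iexp (- (c \<bullet> (x1, x2))) * \<psi> c)
      = of_real (2 * (LINT t|lborel. Re (1 / (k t + \<i> * complex_of_real (t * x1 - x2))\<^sup>2)))"
proof -
  let ?G = "\<lambda>x1 x2 t s. \<bar>s\<bar> *\<^sub>R (exp (- \<bar>s\<bar> * k t) * iexp (s * (t * x1 - x2)))"
  have int: "integrable (lborel \<Otimes>\<^sub>M lborel) (\<lambda>(t, s). ?G x1 x2 t s)" for x1 x2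
  proof (rule lborel_pair.Fubini_integrable)
    have norm_G: "norm (?G x1 x2 t s) = \<bar>s\<bar> * exp (- \<bar>s\<bar> * k t)" for t s
      by (simp add: norm_mult)
    \<comment> \<open>Frequency 0 in the two-sided transform gives the integral of the modulus,
      which Fubini needs.\<close>
    have "has_bochner_integral lborel (\<lambda>s. complex_of_real (\<bar>s\<bar> * exp (- \<bar>s\<bar> * k t))) (complex_of_real (2 * (1 / (k t)\<^sup>2)))" for t
      using has_bochner_integral_laplace_two_sided[OF k(1)[of t], of 0]
      by (simp add: scaleR_conv_of_real flip: of_real_power)
    then have *: "(LINT s|lborel. \<bar>s\<bar> * exp (- \<bar>s\<bar> * k t)) = 2 * (1 / (k t)\<^sup>2)" for t
      by (simp only: has_bochner_integral_iff integral_complex_of_real of_real_eq_iff)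
    then show "integrable lborel (\<lambda>t. LINT s|lborel. norm (case (t, s) of (t, s) \<Rightarrow> ?G x1 x2 t s))"
      unfolding prod.case norm_G * by (intro integrable_mult_right k(2))
    show "AE t in lborel. integrable lborel (\<lambda>s. case (t, s) of (t, s) \<Rightarrow> ?G x1 x2 t s)"
      using has_bochner_integral_laplace_two_sided[OF k(1)]
      by (intro AE_I2) (simp only: prod.case has_bochner_integral_iff)
  qed measurable
  have eq: "\<bar>s\<bar> *\<^sub>R (iexp (- ((- (s * t), s) \<bullet> (x1, x2))) * \<psi> (- (s * t), s)) = ?G x1 x2 t s" for s t x1 x2
    unfolding \<psi> by (simp add: algebra_simps)
  show "integrable lborel \<psi>"
    \<comment> \<open>At \<open>x1 = x2 = 0\<close> the oscillating factor is 1, so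
      \<open>int\<close> is integrability of \<open>\<psi>\<close> itself in the new
      coordinates.\<close>
    using int[of 0 0] by (subst integrable_pair_change_of_variables) (simp_all add: \<psi> lborel_prod)
  have "(CLINT c|lborel. iexp (- (c \<bullet> (x1, x2))) * \<psi> c) = (LINT p|(lborel \<Otimes>\<^sub>M lborel). (case p of (t, s) \<Rightarrow> ?G x1 x2 t s))"
    by (subst integral_pair_change_of_variables, measurable) (simp only: eq lborel_prod)
  also have "\<dots> = (LINT t|lborel. LINT s|lborel. ?G x1 x2 t s)"
    using lborel_pair.integral_fst'[OF int] by simp
  also have "\<dots> = (LINT t|lborel. complex_of_real (2 * Re (1 / (k t + \<i> * complex_of_real (t * x1 - x2))\<^sup>2)))"
    by (simp only: has_bochner_integral_integral_eq[OF has_bochner_integral_laplace_two_sided[OF k(1)]])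
  also have "\<dots> = of_real (2 * (LINT t|lborel. Re (1 / (k t + \<i> * complex_of_real (t * x1 - x2))\<^sup>2)))"
    by (simp only: integral_complex_of_real integral_mult_right_zero)
  finally show "(CLINT c|lborel. iexp (- (c \<bullet> (x1, x2))) * \<psi> c)
      = of_real (2 * (LINT t|lborel. Re (1 / (k t + \<i> * complex_of_real (t * x1 - x2))\<^sup>2)))" .
qed

section \<open>Branches of the arc tangent\<close>

text \<open>\<open>Arctan z\<close> is \<open>\<i> / 2\<close> times the logarithm of
  \<open>(1 - \<i> * z) / (1 + \<i> * z)\<close>. Its real part therefore has the sign opposite to
  the imaginary part of that quotient, which in turn has the sign of \<open>- Re z\<close>.\<close>

lemma
  shows Re_Arctan_pos: "0 < Re z \<Longrightarrow> 0 < Re (Arctan z)"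
    and Re_Arctan_neg: "Re z < 0 \<Longrightarrow> Re (Arctan z) < 0"
proof -
  let ?w = "(1 - \<i> * z) / (1 + \<i> * z)"
  have im: "Im ((1 - \<i> * z) * cnj (1 + \<i> * z)) = - 2 * Re z"
    by (simp add: algebra_simps)
  show "0 < Re (Arctan z)" if "0 < Re z"
  proof -
    have "Im ?w < 0"
      using that im by (simp add: Im_complex_div_lt_0)
    then have "Im (Ln ?w) < 0"
      using Im_Ln_pos_le[of ?w] Im_Ln_le_pi[of ?w] by fastforce
    then show ?thesis
      by (simp add: Arctan_def)
  qed
  show "Re (Arctan z) < 0" if "Re z < 0"
  proof -
    have "0 < Im ?w"
      using that im by (simp add: Im_complex_div_gt_0)
    then have "0 < Im (Ln ?w)"
      using Im_Ln_pos_lt[of ?w] by fastforce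
    then show ?thesis
      by (simp add: Arctan_def)
  qed
qed

text \<open>The logarithm of the quotient and the difference of the logarithms differ by
  \<open>2 * n * pi * \<i>\<close>. For \<open>Re z > 0\<close> the former has imaginary part in
  (-pi, 0) and the latter in (-2 pi, 0), which forces \<open>n = 0\<close>.\<close>

lemma atan_eq_Arctan:
  assumes "0 < Re z"
  shows "atan z = Arctan z"
proof -
  have nz: "1 + \<i> * z \<noteq> 0" "1 - \<i> * z \<noteq> 0"
    using assms by (auto simp: complex_eq_iff)
  have im: "Im (Ln (1 - \<i> * z)) < 0" "0 < Im (Ln (1 + \<i> * z))"
    using Im_Ln_pos_le[OF nz(2)] Im_Ln_le_pi[OF nz(2)] Im_Ln_pos_lt[OF nz(1)] assms by fastforce+
  have "Ln ((1 - \<i> * z) / (1 + \<i> * z)) = Ln (1 - \<i> * z) - Ln (1 + \<i> * z)"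
  proof -
    have "0 < Re (Arctan z)" by (rule Re_Arctan_pos) fact
    then have neg: "Im (Ln ((1 - \<i> * z) / (1 + \<i> * z))) < 0"
      by (simp add: Arctan_def)
    have "exp (Ln ((1 - \<i> * z) / (1 + \<i> * z))) = exp (Ln (1 - \<i> * z) - Ln (1 + \<i> * z))"
      using nz by (simp add: exp_diff)
    then obtain n :: int where n: "Ln ((1 - \<i> * z) / (1 + \<i> * z)) = Ln (1 - \<i> * z) - Ln (1 + \<i> * z) + of_int (2 * n) * pi * \<i>"
      by (auto simp: exp_eq)
    have "Im (Ln ((1 - \<i> * z) / (1 + \<i> * z))) = Im (Ln (1 - \<i> * z)) - Im (Ln (1 + \<i> * z)) + 2 * n * pi"
      unfolding n by simp
    moreover have "- pi < Im (Ln ((1 - \<i> * z) / (1 + \<i> * z)))"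
      using nz by (intro mpi_less_Im_Ln) auto
    moreover have "- pi < Im (Ln (1 - \<i> * z))" "Im (Ln (1 + \<i> * z)) \<le> pi"
      using mpi_less_Im_Ln[OF nz(2)] Im_Ln_le_pi[OF nz(1)] by auto
    ultimately have "- pi < 2 * n * pi" "2 * n * pi < 2 * pi"
      using im neg by linarith+
    then have "-1 < real_of_int (2 * n)" "real_of_int (2 * n) < 2"
      using mult_less_cancel_right_pos[OF pi_gt_zero, of "-1"] mult_less_cancel_right_pos[OF pi_gt_zero, of _ 2] by auto
    then have "n = 0" by linarith
    with n show ?thesis by simp
  qed
  then show ?thesis
    by (simp add: atan_def Arctan_def)
qed

lemma complex_sin_eq_0_imp:
  fixes z :: complex
  assumes "sin z = 0" "\<bar>Re z\<bar> < pi"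
  shows "z = 0"
proof -
  obtain n :: int where n: "z = of_real (n * pi)"
    using assms(1) by (auto simp: sin_eq_0)
  then have "\<bar>real_of_int n\<bar> * pi < 1 * pi"
    using assms(2) by (simp add: abs_mult)
  then have "\<bar>real_of_int n\<bar> < 1"
    using pi_gt_zero by (metis mult_less_cancel_right_pos)
  then have "n = 0" by linarith
  with n show ?thesis by simp
qed

text \<open>The implications on \<open>p\<close> and \<open>q\<close> say that they avoid the branch
  cut. The range from - pi / 2 to pi is what later allows subtracting a value with real part in (0,
  pi / 2] without leaving (-pi, pi), where 0 is the only zero of the sine.\<close>

lemma sin_cos_Arctan_diff:
  fixes p q :: complex
  assumes p: "Re p = 0 \<longrightarrow> \<bar>Im p\<bar> < 1" "p \<noteq> 0" and q: "Re q = 0 \<longrightarrow> \<bar>Im q\<bar> < 1" "q \<noteq> 0"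
    and re: "Re q < Re p"
  shows "cos (Arctan p) * cos (Arctan q) \<noteq> 0"
    "sin (Arctan p - Arctan q) = cos (Arctan p) * cos (Arctan q) * (p - q)"
    "cos (Arctan p - Arctan q) = cos (Arctan p) * cos (Arctan q) * (1 + p * q)"
    "- (pi / 2) < Re (Arctan p - Arctan q)" "Re (Arctan p - Arctan q) < pi"
proof -
  have tan: "tan (Arctan z) = z" if "Re z = 0 \<longrightarrow> \<bar>Im z\<bar> < 1" for z
  proof (rule tan_Arctan)
    show "z\<^sup>2 \<noteq> -1"
    proof
      assume "z\<^sup>2 = -1"
      then have "z = \<i> \<or> z = - \<i>"
        by (simp flip: power2_eq_iff)
      with that show False by auto
    qed
  qed
  \<comment> \<open>If the cosine vanished, division by zero would make the tangent 0, contradicting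
    that \<open>p\<close> and \<open>q\<close> are nonzero.\<close>
  have c: "cos (Arctan p) \<noteq> 0" "cos (Arctan q) \<noteq> 0"
    using tan[OF p(1)] tan[OF q(1)] p(2) q(2) by (auto simp: tan_def)
  have s: "sin (Arctan p) = p * cos (Arctan p)" "sin (Arctan q) = q * cos (Arctan q)"
    using tan[OF p(1)] tan[OF q(1)] c by (auto simp: tan_def field_simps)
  show "cos (Arctan p) * cos (Arctan q) \<noteq> 0"
    using c by simp
  show "sin (Arctan p - Arctan q) = cos (Arctan p) * cos (Arctan q) * (p - q)"
    "cos (Arctan p - Arctan q) = cos (Arctan p) * cos (Arctan q) * (1 + p * q)"
    by (simp_all add: sin_diff cos_diff s algebra_simps)
  have "\<bar>Re (Arctan p)\<bar> < pi / 2" "\<bar>Re (Arctan q)\<bar> < pi / 2"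
    using Re_Arctan_bounds[of p] Re_Arctan_bounds[of q] p(1) q(1) by blast+
  \<comment> \<open>One term of the difference has the favourable sign, which raises the lower bound
    from - pi to - pi / 2.\<close>
  moreover have "0 < Re (Arctan p) \<or> Re (Arctan q) < 0"
    using re Re_Arctan_pos[of p] Re_Arctan_neg[of q] by force
  ultimately show "- (pi / 2) < Re (Arctan p - Arctan q)" "Re (Arctan p - Arctan q) < pi"
    by auto
qed

text \<open>The condition on \<open>v\<close> is the addition formula of the tangent with its
  denominator cleared. It makes the sine of the discrepancy vanish, and the bounds on real parts
  exclude nonzero multiples of pi.\<close>

lemma Arctan_diff_eq_Arctan:
  fixes p q v :: complex
  assumes pq: "Re p = 0 \<longrightarrow> \<bar>Im p\<bar> < 1" "p \<noteq> 0" "Re q = 0 \<longrightarrow> \<bar>Im q\<bar> < 1" "q \<noteq> 0" "Re q < Re p"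
    and v: "0 < Re v" "p - q = v * (1 + p * q)"
  shows "Arctan p - Arctan q = Arctan v"
proof -
  note aux = sin_cos_Arctan_diff[OF pq]
  have "tan (Arctan v) = v"
    using v(1) by (intro tan_Arctan, auto simp: power2_eq_square complex_eq_iff)
      (use zero_le_square[of "Re v"] in linarith)
  moreover from this have "cos (Arctan v) \<noteq> 0"
    using v(1) by (auto simp: tan_def)
  ultimately have sv: "sin (Arctan v) = v * cos (Arctan v)"
    by (simp add: tan_def field_simps)
  have "sin (Arctan p - Arctan q - Arctan v) = 0"
    unfolding sin_diff[of "Arctan p - Arctan q"] aux(2,3) sv v(2) by simp
  moreover have "\<bar>Re (Arctan p - Arctan q - Arctan v)\<bar> < pi"
  proof -
    have "0 < Re (Arctan v)" "\<bar>Re (Arctan v)\<bar> < pi / 2"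
      using v(1) Re_Arctan_pos[of v] Re_Arctan_bounds[of v] by simp_all
    then show ?thesis using aux(4,5) by (simp add: abs_less_iff)
  qed
  ultimately have "Arctan p - Arctan q - Arctan v = 0"
    by (rule complex_sin_eq_0_imp)
  then show ?thesis by simp
qed

text \<open>Here the cosine of the difference vanishes, so the addition formula has a pole; the same
  confinement of the real part selects pi / 2.\<close>

lemma Arctan_diff_eq_pi_half:
  fixes p q :: complex
  assumes pq: "Re p = 0 \<longrightarrow> \<bar>Im p\<bar> < 1" "p \<noteq> 0" "Re q = 0 \<longrightarrow> \<bar>Im q\<bar> < 1" "q \<noteq> 0" "Re q < Re p"
    and v: "1 + p * q = 0"
  shows "Arctan p - Arctan q = pi / 2"
proof -
  note aux = sin_cos_Arctan_diff[OF pq]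
  have "sin (Arctan p - Arctan q - pi / 2) = 0"
    unfolding sin_diff[of "Arctan p - Arctan q"] aux(2,3) v
    by simp
  moreover have "\<bar>Re (Arctan p - Arctan q - pi / 2)\<bar> < pi"
    using aux(4,5) by (simp add: abs_less_iff)
  ultimately have "Arctan p - Arctan q - pi / 2 = 0"
    by (rule complex_sin_eq_0_imp)
  then show ?thesis by simp
qed

section \<open>The integral over the line\<close>

text \<open>The real part of \<open>\<alpha> * t + \<beta>\<close> grows from a positive value, so
  the antiderivative \<open>- 1 / (\<alpha> * (\<alpha> * t + \<beta>))\<close> meets no pole and
  tends to 0.\<close>

lemma integral_inverse_square_linear_Ici:
  fixes \<alpha> \<beta> :: complex and c :: real
  assumes \<alpha>: "0 < Re \<alpha>" and \<beta>: "0 < Re (\<alpha> * c + \<beta>)"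
    and int: "set_integrable lborel {c<..} (\<lambda>t. 1 / (\<alpha> * t + \<beta>)\<^sup>2)"
  shows "(CLBINT t=c..\<infinity>. 1 / (\<alpha> * t + \<beta>)\<^sup>2) = 1 / (\<alpha> * (\<alpha> * c + \<beta>))"
proof -
  have Re_pos: "0 < Re (\<alpha> * t + \<beta>)" if "c \<le> t" for t :: real
    using mult_left_mono[OF that less_imp_le[OF \<alpha>]] \<beta> by simp
  then have nz: "\<alpha> * t + \<beta> \<noteq> 0" "\<alpha> \<noteq> 0" if "c \<le> t" for t :: real
    using that \<alpha> by fastforce+
  let ?F = "\<lambda>t::real. - 1 / (\<alpha> * (\<alpha> * t + \<beta>))"
  have F: "(?F has_vector_derivative 1 / (\<alpha> * t + \<beta>)\<^sup>2) (at t)" if "c \<le> t" for t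
  proof -
    have "((\<lambda>z. - 1 / (\<alpha> * (\<alpha> * z + \<beta>))) has_field_derivative 1 / (\<alpha> * t + \<beta>)\<^sup>2) (at (complex_of_real t))"
      using nz[OF that] by (auto intro!: derivative_eq_intros simp: power2_eq_square)
    then show ?thesis by (rule has_vector_derivative_real_field)
  qed
  have "(CLBINT t=c..\<infinity>. 1 / (\<alpha> * t + \<beta>)\<^sup>2) = 0 - ?F c"
  proof (rule interval_integral_FTC_integrable)
    show "(?F has_vector_derivative 1 / (\<alpha> * t + \<beta>)\<^sup>2) (at t)" if "ereal c < ereal t" for t
      using F that by simp
    show "isCont (\<lambda>t::real. 1 / (\<alpha> * t + \<beta>)\<^sup>2) t" if "ereal c < ereal t" for t
      using nz[of t] that by (intro continuous_intros) auto
    show "set_integrable lborel (einterval (ereal c) \<infinity>) (\<lambda>t. 1 / (\<alpha> * t + \<beta>)\<^sup>2)"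
      using int by simp
    have "isCont ?F c"
      using F[of c] by (auto intro: has_vector_derivative_continuous)
    then show "((?F \<circ> real_of_ereal) \<longlongrightarrow> ?F c) (at_right (ereal c))"
      unfolding ereal_tendsto_simps by (auto simp: isCont_def intro: tendsto_within_subset)
    have "(?F \<longlongrightarrow> 0) at_top"
    proof (rule Lim_null_comparison)
      show "eventually (\<lambda>t. norm (?F t) \<le> 1 / (norm \<alpha> * (Re \<alpha> * t + Re \<beta>))) at_top"
        using eventually_ge_at_top[of c]
      proof eventually_elim
        case (elim t)
        have "Re \<alpha> * t + Re \<beta> \<le> norm (\<alpha> * t + \<beta>)"
          using complex_Re_le_cmod[of "\<alpha> * t + \<beta>"] by simp
        then show ?case
          using Re_pos[OF elim] nz[OF elim] by (auto simp: norm_divide norm_mult intro!: divide_left_mono mult_left_mono mult_pos_pos)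
      qed
      show "((\<lambda>t. 1 / (norm \<alpha> * (Re \<alpha> * t + Re \<beta>))) \<longlongrightarrow> 0) at_top"
        using \<alpha> nz(2)[of c] by real_asymp
    qed
    then show "((?F \<circ> real_of_ereal) \<longlongrightarrow> 0) (at_left \<infinity>)"
      unfolding ereal_tendsto_simps .
  qed simp
  then show ?thesis by simp
qed

text \<open>This is the usual reduction of the integral of \<open>1 / (u^2 + D)^2\<close> to that of
  \<open>1 / (u^2 + D)\<close>; the factor \<open>1 / (2 * R ^ 3)\<close> combines
  \<open>1 / (2 * D)\<close> with the scaling of the arc tangent by \<open>R\<close>. The second
  claim keeps the complex arc tangent differentiable on the path and is needed again at the
  endpoints.\<close>

lemma integral_inverse_square_quadratic:
  fixes D \<tau>0 R :: complex
  assumes R: "R\<^sup>2 = D" "0 < Re D"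
    and pos: "\<And>t. 0 \<le> t \<Longrightarrow> t \<le> 1 \<Longrightarrow> 0 < Re ((complex_of_real t + \<tau>0)\<^sup>2 + D)"
  shows "(CLBINT t=0..1. 1 / ((complex_of_real t + \<tau>0)\<^sup>2 + D)\<^sup>2)
    = (1 + \<tau>0) / (2 * D * ((1 + \<tau>0)\<^sup>2 + D)) - \<tau>0 / (2 * D * (\<tau>0\<^sup>2 + D))
      + (Arctan ((1 + \<tau>0) / R) - Arctan (\<tau>0 / R)) / (2 * R ^ 3)"
    and "0 \<le> t \<Longrightarrow> t \<le> 1 \<Longrightarrow> Re ((complex_of_real t + \<tau>0) / R) = 0 \<longrightarrow> \<bar>Im ((complex_of_real t + \<tau>0) / R)\<bar> < 1"
proof -
  have nz: "D \<noteq> 0" "R \<noteq> 0"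
    using R by auto
  show cut: "Re ((complex_of_real t + \<tau>0) / R) = 0 \<longrightarrow> \<bar>Im ((complex_of_real t + \<tau>0) / R)\<bar> < 1"
    if t: "0 \<le> t" "t \<le> 1" for t
  proof
    let ?z = "(complex_of_real t + \<tau>0) / R"
    have sq: "z\<^sup>2 = of_real (- ((Im z)\<^sup>2))" if "Re z = 0" for z
      using that by (simp add: complex_eq_iff power2_eq_square)
    assume "Re ?z = 0"
    then have z2: "?z\<^sup>2 = of_real (- ((Im ?z)\<^sup>2))"
      by (rule sq)
    \<comment> \<open>If the ratio is \<open>\<i> * y\<close> with \<open>y\<close> real, the
      quadratic equals \<open>D * (1 - y^2)\<close>; positivity of both real parts then forces
      \<open>y^2 < 1\<close>.\<close>
    have "(complex_of_real t + \<tau>0)\<^sup>2 + D = D * (1 + ?z\<^sup>2)"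
      using nz R(1) by (simp add: field_simps)
    also have "\<dots> = D * of_real (1 - (Im ?z)\<^sup>2)"
      unfolding z2 by simp
    finally have "0 < Re D * (1 - (Im ?z)\<^sup>2)"
      using pos[OF t] by simp
    then have "(Im ?z)\<^sup>2 < 1"
      using R(2) by (simp add: zero_less_mult_iff)
    then show "\<bar>Im ?z\<bar> < 1"
      by (simp add: abs_square_less_1)
  qed
  let ?P = "\<lambda>z. (z + \<tau>0)\<^sup>2 + D"
  let ?F = "\<lambda>z. (z + \<tau>0) / (2 * D * ?P z) + Arctan ((z + \<tau>0) / R) / (2 * R ^ 3)"
  have F: "((\<lambda>t. ?F (complex_of_real t)) has_vector_derivative 1 / (?P (complex_of_real t))\<^sup>2) (at t)" if t: "0 \<le> t" "t \<le> 1" for t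
  proof -
    have P: "?P (complex_of_real t) \<noteq> 0"
      using pos[OF t] by fastforce
    have *: "1 + ((complex_of_real t + \<tau>0) / R)\<^sup>2 = ?P (complex_of_real t) / D"
      using nz R(1) by (simp add: field_simps)
    let ?z = "complex_of_real t"
    have "(?P has_field_derivative 2 * (?z + \<tau>0)) (at ?z)"
      by (auto intro!: derivative_eq_intros)
    then have "((\<lambda>z. (z + \<tau>0) / (2 * D * ?P z)) has_field_derivative
        (1 * (2 * D * ?P ?z) - (?z + \<tau>0) * (2 * D * (2 * (?z + \<tau>0)))) / ((2 * D * ?P ?z) * (2 * D * ?P ?z))) (at ?z)"
      using P nz by (intro DERIV_divide DERIV_cmult) (auto intro!: derivative_eq_intros)
    moreover have e1: "(1 * (2 * D * w) - u * (2 * D * (2 * u))) / ((2 * D * w) * (2 * D * w))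
        = 1 / (2 * D * w) - 2 * u\<^sup>2 / (2 * D * w\<^sup>2)" if "w \<noteq> 0" for u w
      using that nz by (simp add: field_simps power2_eq_square)
    ultimately have A: "((\<lambda>z. (z + \<tau>0) / (2 * D * ?P z)) has_field_derivative
        1 / (2 * D * ?P ?z) - 2 * (?z + \<tau>0)\<^sup>2 / (2 * D * (?P ?z)\<^sup>2)) (at ?z)"
      by (simp only: e1[OF P])
    have d1: "((\<lambda>z. (z + \<tau>0) / R) has_field_derivative 1 / R) (at ?z)"
      using nz by (auto intro!: derivative_eq_intros)
    have d2: "(Arctan has_field_derivative inverse (1 + ((?z + \<tau>0) / R)\<^sup>2)) (at ((?z + \<tau>0) / R))"
      using cut[OF t] by (intro has_field_derivative_Arctan) auto
    have "((\<lambda>z. Arctan ((z + \<tau>0) / R) / (2 * R ^ 3)) has_field_derivative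
        inverse (1 + ((?z + \<tau>0) / R)\<^sup>2) * (1 / R) / (2 * R ^ 3)) (at ?z)"
      by (rule DERIV_cdivide[OF DERIV_chain2[OF d2 d1]])
    moreover have e2: "inverse (w / D) * (1 / R) / (2 * R ^ 3) = 1 / (2 * D * w)" if "w \<noteq> 0" for w
      using that nz by (simp add: R(1)[symmetric] field_simps power2_eq_square power3_eq_cube)
    ultimately have "((\<lambda>z. Arctan ((z + \<tau>0) / R) / (2 * R ^ 3)) has_field_derivative 1 / (2 * D * ?P ?z)) (at ?z)"
      by (simp only: * e2[OF P])
    from DERIV_add[OF A this]
    have "(?F has_field_derivative
        1 / (2 * D * ?P ?z) - 2 * (?z + \<tau>0)\<^sup>2 / (2 * D * (?P ?z)\<^sup>2) + 1 / (2 * D * ?P ?z)) (at ?z)" .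
    \<comment> \<open>The numerator \<open>w - D\<close> stands for \<open>u^2\<close>, so the two
      simple fractions cancel and only \<open>1 / w^2\<close> is left.\<close>
    moreover have e4: "1 / (2 * D * w) - 2 * (w - D) / (2 * D * w\<^sup>2) + 1 / (2 * D * w) = 1 / w\<^sup>2" if "w \<noteq> 0" for w
      using that nz by (simp add: field_simps power2_eq_square)
    then have e3: "1 / (2 * D * ?P ?z) - 2 * (?z + \<tau>0)\<^sup>2 / (2 * D * (?P ?z)\<^sup>2) + 1 / (2 * D * ?P ?z) = 1 / (?P ?z)\<^sup>2"
      using P e4[of "?P ?z"] by simp
    ultimately have "(?F has_field_derivative 1 / (?P ?z)\<^sup>2) (at ?z)"
      by (simp only: e3)
    then show ?thesis by (rule has_vector_derivative_real_field)
  qed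
  have "(CLBINT t=ereal 0..ereal 1. 1 / (?P (complex_of_real t))\<^sup>2) = ?F (complex_of_real 1) - ?F (complex_of_real 0)"
  proof (rule interval_integral_FTC_finite)
    show "continuous_on {min 0 1..max 0 1} (\<lambda>t. 1 / (?P (complex_of_real t))\<^sup>2)"
      using pos by (intro continuous_intros) fastforce
    show "((\<lambda>t. ?F (complex_of_real t)) has_vector_derivative 1 / (?P (complex_of_real t))\<^sup>2) (at t within {min 0 1..max 0 1})"
      if "min 0 1 \<le> t" "t \<le> max 0 1" for t
      by (rule has_vector_derivative_at_within[OF F]) (use that in auto)
  qed
  then show "(CLBINT t=0..1. 1 / ((complex_of_real t + \<tau>0)\<^sup>2 + D)\<^sup>2)
    = (1 + \<tau>0) / (2 * D * ((1 + \<tau>0)\<^sup>2 + D)) - \<tau>0 / (2 * D * (\<tau>0\<^sup>2 + D))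
      + (Arctan ((1 + \<tau>0) / R) - Arctan (\<tau>0 / R)) / (2 * R ^ 3)"
    by (simp only: zero_ereal_def one_ereal_def of_real_0 of_real_1 add_0_left add_diff_add diff_divide_distrib)
qed

text \<open>The tails contribute \<open>1 / (b * W 0)\<close> and \<open>1 / (a * W 1)\<close>, the
  middle piece its boundary terms and the arc tangents. Tails and boundary terms merge because
  \<open>4 * W 0 = b^2 + Q\<close> and \<open>4 * W 1 = a^2 + Q\<close>. The last two claims record
  that the arc tangents are evaluated off their cut.\<close>

lemma mean_dist_line_integral:
  fixes x1 x2 :: real
  defines "Q \<equiv> 1 - 2 * \<i> * complex_of_real x1 + (complex_of_real x1)\<^sup>2 + 4 * \<i> * complex_of_real x2"
    and "a \<equiv> 1 - \<i> * x1" and "b \<equiv> 1 + \<i> * x1"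
  shows "(LINT t|lborel. Re (1 / (mean_dist t + \<i> * of_real (t * x1 - x2))\<^sup>2))
      = 8 / (norm Q)\<^sup>2 + 4 * Re ((Arctan (a / csqrt Q) - Arctan (- b / csqrt Q)) / csqrt Q ^ 3)" (is ?A)
    and "Re (a / csqrt Q) = 0 \<longrightarrow> \<bar>Im (a / csqrt Q)\<bar> < 1" (is ?B)
    and "Re (- b / csqrt Q) = 0 \<longrightarrow> \<bar>Im (- b / csqrt Q)\<bar> < 1" (is ?C)
proof -
  \<comment> \<open>\<open>W\<close> is the conjugate of the base in the integrand; real parts
    agree, and its quadratic piece involves \<open>Q\<close> itself and not its conjugate.\<close>
  define W where "W t = mean_dist t + \<i> * of_real (x2 - t * x1)" for t
  define \<tau> where "\<tau> = - b / 2"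
  define S where "S = csqrt Q"
  have S2: "S\<^sup>2 = Q" by (simp add: S_def)
  have ReQ: "Re Q = 1 + x1\<^sup>2" by (simp add: Q_def power2_eq_square)
  then have ReQ_pos: "0 < Re Q" by (simp add: add_pos_nonneg)
  then have nz: "Q \<noteq> 0" "S \<noteq> 0" using S2 by auto
  have ab: "a \<noteq> 0" "b \<noteq> 0" by (auto simp: a_def b_def complex_eq_iff)
  have ReW: "Re (W t) = mean_dist t" for t
    by (simp add: W_def)
  \<comment> \<open>Completing the square: the linear coefficient is \<open>- b\<close>, hence the
    shift \<open>- b / 2\<close>, and the remaining constant is \<open>Q / 4\<close>.\<close>
  have W_quadratic: "W t = (complex_of_real t + \<tau>)\<^sup>2 + Q / 4" if "0 \<le> t" "t \<le> 1" for t
    using that by (simp add: W_def \<tau>_def b_def Q_def complex_eq_iff mean_dist_simps power2_eq_square field_simps)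
  have W_right: "W t = a * t + (\<i> * x2 - 1 / 2)" if "1 \<le> t" for t
    using that by (simp add: W_def a_def complex_eq_iff mean_dist_simps)
  have W_left: "W (- t) = b * t + (\<i> * x2 + 1 / 2)" if "0 \<le> t" for t
    using that by (simp add: W_def b_def complex_eq_iff mean_dist_simps)
  have norm_le: "norm (1 / (W t)\<^sup>2) \<le> 1 / (mean_dist t)\<^sup>2" for t
    using complex_Re_le_cmod[of "W t"] mean_dist_pos[of t]
    by (auto simp: norm_divide norm_power ReW intro!: divide_left_mono power_mono mult_pos_pos)
  have int: "integrable lborel (\<lambda>t. 1 / (W t)\<^sup>2)"
    by (rule Bochner_Integration.integrable_bound[OF integrable_inverse_mean_dist])
       (use norm_le in \<open>auto simp: W_def\<close>)
  have sint: "set_integrable lborel A (\<lambda>t. 1 / (W t)\<^sup>2)" if "A \<in> sets borel" for A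
    using int that by (auto simp: set_integrable_def intro!: integrable_mult_indicator)
  have pos: "0 < Re ((complex_of_real t + \<tau>)\<^sup>2 + Q / 4)" if "0 \<le> t" "t \<le> 1" for t
    using ReW[of t] mean_dist_pos[of t] W_quadratic[OF that] by simp
  have R: "(S / 2)\<^sup>2 = Q / 4" "0 < Re (Q / 4)"
    using S2 ReQ_pos by (simp_all add: power_divide)
  have \<tau>1: "(1 + \<tau>) / (S / 2) = a / S" "\<tau> / (S / 2) = - b / S"
    using nz by (simp_all add: \<tau>_def a_def b_def field_simps)
  note cut = integral_inverse_square_quadratic(2)[OF R pos]
  show ?B
    using cut[of 1] unfolding of_real_1 \<tau>1 unfolding S_def by simp
  show ?C
    using cut[of 0] unfolding of_real_0 add_0_left \<tau>1 unfolding S_def by simp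
  have W1: "4 * W 1 = a\<^sup>2 + Q" and W0: "4 * W 0 = b\<^sup>2 + Q"
    unfolding W_def a_def b_def Q_def by (simp_all add: complex_eq_iff mean_dist_simps power2_eq_square algebra_simps)
  have Wnz: "W t \<noteq> 0" for t
    using ReW[of t] mean_dist_pos[of t] by auto
  have mid: "(CLBINT t=0..1. 1 / (W t)\<^sup>2) = a / (Q * W 1) + b / (Q * W 0) + 4 * ((Arctan (a / S) - Arctan (- b / S)) / S ^ 3)"
  proof -
    have "(CLBINT t=0..1. 1 / (W t)\<^sup>2) = (CLBINT t=0..1. 1 / ((complex_of_real t + \<tau>)\<^sup>2 + Q / 4)\<^sup>2)"
      by (rule interval_integral_cong) (auto simp: W_quadratic zero_ereal_def one_ereal_def)
    also have "\<dots> = (1 + \<tau>) / (2 * (Q / 4) * ((1 + \<tau>)\<^sup>2 + Q / 4)) - \<tau> / (2 * (Q / 4) * (\<tau>\<^sup>2 + Q / 4))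
        + (Arctan ((1 + \<tau>) / (S / 2)) - Arctan (\<tau> / (S / 2))) / (2 * (S / 2) ^ 3)"
      by (rule integral_inverse_square_quadratic(1)[OF R]) (rule pos)
    also have "\<dots> = (1 + \<tau>) / (2 * (Q / 4) * W 1) - \<tau> / (2 * (Q / 4) * W 0)
        + (Arctan (a / S) - Arctan (- b / S)) / (2 * (S / 2) ^ 3)"
      unfolding \<tau>1 using W_quadratic[of 0] W_quadratic[of 1] by simp
    also have "(1 + \<tau>) / (2 * (Q / 4) * W 1) = a / (Q * W 1)"
    proof -
      have "1 + \<tau> = a / 2"
        by (simp add: \<tau>_def a_def b_def field_simps)
      then show ?thesis by simp
    qed
    also have "\<tau> / (2 * (Q / 4) * W 0) = - b / (Q * W 0)"
      by (simp add: \<tau>_def)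
    also have "(Arctan (a / S) - Arctan (- b / S)) / (2 * (S / 2) ^ 3) = 4 * ((Arctan (a / S) - Arctan (- b / S)) / S ^ 3)"
      by (simp add: power_divide)
    finally show ?thesis by simp
  qed
  have right: "(CLBINT t=1..\<infinity>. 1 / (W t)\<^sup>2) = 1 / (a * W 1)"
  proof -
    have "(CLBINT t=1..\<infinity>. 1 / (W t)\<^sup>2) = (CLBINT t=ereal 1..\<infinity>. 1 / (a * t + (\<i> * x2 - 1 / 2))\<^sup>2)"
      unfolding one_ereal_def by (rule interval_integral_cong) (auto simp: W_right)
    also have "\<dots> = 1 / (a * (a * complex_of_real 1 + (\<i> * x2 - 1 / 2)))"
    proof (rule integral_inverse_square_linear_Ici)
      show "0 < Re a" "0 < Re (a * complex_of_real 1 + (\<i> * x2 - 1 / 2))"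
        by (simp_all add: a_def)
      show "set_integrable lborel {1<..} (\<lambda>t::real. 1 / (a * t + (\<i> * x2 - 1 / 2))\<^sup>2)"
      proof -
        have "set_integrable lborel {1<..} (\<lambda>t. 1 / (W t)\<^sup>2)
            = set_integrable lborel {1<..} (\<lambda>t::real. 1 / (a * t + (\<i> * x2 - 1 / 2))\<^sup>2)"
          by (intro set_integrable_cong) (auto simp: W_right)
        then show ?thesis
          using sint[of "{1<..}"] by simp
      qed
    qed
    finally show ?thesis
      using W_right[of 1] by simp
  qed
  have left: "(CLBINT t=-\<infinity>..0. 1 / (W t)\<^sup>2) = 1 / (b * W 0)"
  proof -
    have "(CLBINT t=-\<infinity>..0. 1 / (W t)\<^sup>2) = (CLBINT t=0..\<infinity>. 1 / (W (- t))\<^sup>2)"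
      by (subst interval_integral_reflect) simp
    also have "\<dots> = (CLBINT t=ereal 0..\<infinity>. 1 / (b * t + (\<i> * x2 + 1 / 2))\<^sup>2)"
      unfolding zero_ereal_def by (rule interval_integral_cong) (auto simp: W_left)
    also have "\<dots> = 1 / (b * (b * complex_of_real 0 + (\<i> * x2 + 1 / 2)))"
    proof (rule integral_inverse_square_linear_Ici)
      show "0 < Re b" "0 < Re (b * complex_of_real 0 + (\<i> * x2 + 1 / 2))"
        by (simp_all add: b_def)
      have "integrable lborel (\<lambda>t. 1 / (W (- t))\<^sup>2)"
        using lborel_integrable_real_affine_iff[of "-1" "\<lambda>t. 1 / (W t)\<^sup>2" 0] int by simp
      then have "set_integrable lborel {0<..} (\<lambda>t. 1 / (W (- t))\<^sup>2)"
        by (auto simp: set_integrable_def intro!: integrable_mult_indicator)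
      moreover have "set_integrable lborel {0<..} (\<lambda>t. 1 / (W (- t))\<^sup>2)
          = set_integrable lborel {0<..} (\<lambda>t::real. 1 / (b * t + (\<i> * x2 + 1 / 2))\<^sup>2)"
        by (intro set_integrable_cong) (auto simp: W_left)
      ultimately show "set_integrable lborel {0<..} (\<lambda>t::real. 1 / (b * t + (\<i> * x2 + 1 / 2))\<^sup>2)"
        by simp
    qed
    finally show ?thesis
      using W_left[of 0] by simp
  qed
  have "(CLINT t|lborel. 1 / (W t)\<^sup>2) = (CLBINT t=-\<infinity>..\<infinity>. 1 / (W t)\<^sup>2)"
    by (simp add: interval_lebesgue_integral_def set_lebesgue_integral_def)
  also have "\<dots> = (CLBINT t=-\<infinity>..0. 1 / (W t)\<^sup>2) + (CLBINT t=0..1. 1 / (W t)\<^sup>2) + (CLBINT t=1..\<infinity>. 1 / (W t)\<^sup>2)"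
  proof -
    have il: "interval_lebesgue_integrable lborel u v (\<lambda>t. 1 / (W t)\<^sup>2)" for u v
      by (simp add: interval_lebesgue_integrable_def sint)
    show ?thesis
      by (simp add: interval_integral_sum[OF il])
  qed
  also have "\<dots> = (1 / (b * W 0) + b / (Q * W 0)) + (1 / (a * W 1) + a / (Q * W 1))
      + 4 * ((Arctan (a / S) - Arctan (- b / S)) / S ^ 3)"
    unfolding left mid right by simp
  also have "1 / (b * W 0) + b / (Q * W 0) = 4 / (b * Q)"
  proof -
    have "1 / (b * W 0) + b / (Q * W 0) = (b\<^sup>2 + Q) / (b * Q * W 0)"
      using nz ab Wnz[of 0] by (simp add: field_simps power2_eq_square)
    then show ?thesis
      using Wnz[of 0] by (simp flip: W0)
  qed
  also have "1 / (a * W 1) + a / (Q * W 1) = 4 / (a * Q)"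
  proof -
    have "1 / (a * W 1) + a / (Q * W 1) = (a\<^sup>2 + Q) / (a * Q * W 1)"
      using nz ab Wnz[of 1] by (simp add: field_simps power2_eq_square)
    then show ?thesis
      using Wnz[of 1] by (simp flip: W1)
  qed
  also have "4 / (b * Q) + 4 / (a * Q) = of_real (8 / (1 + x1\<^sup>2)) / Q"
  proof -
    have "4 / (b * Q) + 4 / (a * Q) = 4 * (a + b) / (a * b) / Q"
      using nz ab by (simp add: field_simps)
    moreover have "a + b = 2" "a * b = of_real (1 + x1\<^sup>2)"
      by (simp_all add: a_def b_def algebra_simps power2_eq_square)
    ultimately show ?thesis by simp
  qed
  finally have total: "(CLINT t|lborel. 1 / (W t)\<^sup>2) = of_real (8 / (1 + x1\<^sup>2)) / Q
      + 4 * ((Arctan (a / S) - Arctan (- b / S)) / S ^ 3)" .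
  have "Re (of_real r / Q) = r * Re Q / (norm Q)\<^sup>2" for r
    by (simp add: Re_divide cmod_power2)
  then have "Re (of_real (8 / (1 + x1\<^sup>2)) / Q) = 8 / (1 + x1\<^sup>2) * Re Q / (norm Q)\<^sup>2" .
  \<comment> \<open>The factor \<open>1 + x1^2\<close>, which came from \<open>a * b\<close>, is
    also \<open>Re Q\<close> and cancels.\<close>
  also have "\<dots> = 8 / (norm Q)\<^sup>2"
    using ReQ_pos by (simp flip: ReQ)
  finally have rational: "Re (of_real (8 / (1 + x1\<^sup>2)) / Q) = 8 / (norm Q)\<^sup>2" .
  have "Re (1 / (mean_dist t + \<i> * of_real (t * x1 - x2))\<^sup>2) = Re (1 / (W t)\<^sup>2)" for t
  proof -
    have "mean_dist t + \<i> * of_real (t * x1 - x2) = cnj (W t)"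
      by (simp add: W_def complex_eq_iff)
    then have "1 / (mean_dist t + \<i> * of_real (t * x1 - x2))\<^sup>2 = cnj (1 / (W t)\<^sup>2)"
      by simp
    then show ?thesis by (metis cnj.sel(1))
  qed
  then have "(LINT t|lborel. Re (1 / (mean_dist t + \<i> * of_real (t * x1 - x2))\<^sup>2)) = Re (CLINT t|lborel. 1 / (W t)\<^sup>2)"
    using integral_Re[OF int] by simp
  moreover have "Re (4 * z) = 4 * Re z" for z
    by simp
  ultimately show ?A
    unfolding total plus_complex.sel rational S_def[symmetric] by (simp only:)
qed

section \<open>The density\<close>

lemma csqrt_cubed:
  assumes "Q \<noteq> 0"
  shows "csqrt Q ^ 3 = Q powr (3 / 2)"
proof -
  have "csqrt Q ^ 3 = exp (3 * (Ln Q / 2))"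
    using assms exp_of_nat_mult[of 3 "Ln Q / 2"] by (simp add: csqrt_exp_Ln)
  then show ?thesis
    using assms by (simp add: powr_def)
qed

text \<open>Put \<open>p = a / S\<close> and \<open>q = - b / S\<close> with
  \<open>S = csqrt Q\<close>. Then \<open>p - q = 2 / S\<close>, while
  \<open>1 + p * q = (Q - a * b) / Q\<close> keeps only the imaginary part of \<open>Q\<close> in
  its numerator because \<open>a * b = Re Q\<close>. The quotient of the two is the argument of
  \<open>atan\<close>.\<close>

lemma Arctan_diff_eq_atan:
  fixes x1 x2 :: real
  defines "Q \<equiv> 1 - 2 * \<i> * complex_of_real x1 + (complex_of_real x1)\<^sup>2 + 4 * \<i> * complex_of_real x2"
    and "a \<equiv> 1 - \<i> * x1" and "b \<equiv> 1 + \<i> * x1"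
  shows "x1 \<noteq> 2 * x2 \<Longrightarrow> Arctan (a / csqrt Q) - Arctan (- b / csqrt Q) = atan (\<i> * csqrt Q / of_real (x1 - 2 * x2))"
    and "x1 = 2 * x2 \<Longrightarrow> Arctan (a / csqrt Q) - Arctan (- b / csqrt Q) = pi / 2"
proof -
  define S where "S = csqrt Q"
  have S2: "S\<^sup>2 = Q" by (simp add: S_def)
  have ReQ: "Re Q = 1 + x1\<^sup>2" and ImQ: "Im Q = - 2 * (x1 - 2 * x2)"
    by (simp_all add: Q_def power2_eq_square)
  then have "0 < Re Q" by (simp add: add_pos_nonneg)
  then have Q: "Q \<noteq> 0" by auto
  have "Re S \<noteq> 0"
  proof
    assume "Re S = 0"
    then have "Re Q = - (Im S)\<^sup>2"
      using arg_cong[OF S2, of Re] by (simp add: power2_eq_square)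
    with \<open>0 < Re Q\<close> zero_le_power2[of "Im S"] show False by linarith
  qed
  then have S: "S \<noteq> 0" "0 < Re S"
    using csqrt_principal[of Q] by (auto simp: S_def)
  have ab: "a \<noteq> 0" "b \<noteq> 0" "a + b = 2" "a * b = of_real (1 + x1\<^sup>2)"
    by (auto simp: a_def b_def complex_eq_iff power2_eq_square)
  have diff: "a / S - - b / S = 2 / S"
    using ab(3) by (simp flip: add_divide_distrib)
  have prod: "1 + a / S * (- b / S) = (Q - of_real (1 + x1\<^sup>2)) / Q"
    using ab(4) S Q by (simp add: field_simps flip: power2_eq_square S2)
  also have "Q - of_real (1 + x1\<^sup>2) = - 2 * \<i> * of_real (x1 - 2 * x2)"
    by (simp add: Q_def algebra_simps)
  finally have prod: "1 + a / S * (- b / S) = - 2 * \<i> * of_real (x1 - 2 * x2) / Q" .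
  have "0 < Re (2 / S)"
    using S by (simp add: Re_divide sum_power2_gt_zero_iff complex_neq_0)
  then have re: "Re (- b / S) < Re (a / S)"
    using arg_cong[OF diff, of Re] by simp
  have nz: "a / S \<noteq> 0" "- b / S \<noteq> 0"
    using ab S by auto
  have cut: "Re (a / S) = 0 \<longrightarrow> \<bar>Im (a / S)\<bar> < 1" "Re (- b / S) = 0 \<longrightarrow> \<bar>Im (- b / S)\<bar> < 1"
    unfolding S_def Q_def a_def b_def by (rule mean_dist_line_integral(2,3))+
  note conds = cut(1) nz(1) cut(2) nz(2) re
  show "Arctan (a / csqrt Q) - Arctan (- b / csqrt Q) = pi / 2" if eq: "x1 = 2 * x2"
    unfolding S_def[symmetric]
    by (rule Arctan_diff_eq_pi_half[OF conds]) (unfold prod, simp add: eq)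
  show "Arctan (a / csqrt Q) - Arctan (- b / csqrt Q) = atan (\<i> * csqrt Q / of_real (x1 - 2 * x2))" if neq: "x1 \<noteq> 2 * x2"
  proof -
    let ?v = "\<i> * S / of_real (x1 - 2 * x2)"
    define e where "e = x1 - 2 * x2"
    have "e \<noteq> 0" using neq by (simp add: e_def)
    \<comment> \<open>Comparing imaginary parts in \<open>S^2 = Q\<close> gives
      \<open>Re ?v = 1 / Re S\<close>, which is positive whatever the sign of
      \<open>x1 - 2 * x2\<close>. Hence \<open>atan\<close> is only ever evaluated in the right
      half-plane, where it agrees with \<open>Arctan\<close>.\<close>
    have "Re S * Im S = - e"
      using arg_cong[OF S2, of Im] ImQ by (simp add: e_def power2_eq_square algebra_simps)
    moreover have "Re ?v = - Im S / e"
      unfolding e_def[symmetric] by simp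
    ultimately have "Re ?v = 1 / Re S"
      using S \<open>e \<noteq> 0\<close> by (simp only:) (simp add: divide_simps, simp add: mult.commute)
    then have v: "0 < Re ?v"
      using S by simp
    have "2 / S = \<i> * S / e * (- 2 * \<i> * e / S\<^sup>2)" if "e \<noteq> 0" for e
      using that S by (simp add: field_simps power2_eq_square)
    then have "2 / S = ?v * (- 2 * \<i> * of_real (x1 - 2 * x2) / Q)"
      unfolding S2[symmetric] using neq by (metis of_real_eq_0_iff right_minus_eq)
    then have "a / S - - b / S = ?v * (1 + a / S * (- b / S))"
      unfolding diff prod .
    then show ?thesis
      unfolding S_def[symmetric] atan_eq_Arctan[OF v] by (rule Arctan_diff_eq_Arctan[OF conds v])
  qed
qed

text \<open>The normalisation \<open>2 * pi^2\<close> is the inversion constant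
  \<open>(2 * pi)^2\<close> divided by the factor 2 of the two-sided Laplace transform.\<close>

lemma continuous_density_mean_dist:
  fixes M :: "'w measure" and Z :: "'w \<Rightarrow> real \<times> real"
  assumes "prob_space M" and Z: "cauchy_stochastic_integral M 0 1 (\<lambda>x. (1, x)) Z"
  defines "f \<equiv> \<lambda>(x1, x2). (LINT t|lborel. Re (1 / (mean_dist t + \<i> * of_real (t * x1 - x2))\<^sup>2)) / (2 * pi\<^sup>2)"
  shows "continuous_density M Z f"
proof -
  let ?\<mu> = "distr M borel Z"
  have [measurable]: "Z \<in> borel_measurable M"
    and char: "vec_char ?\<mu> c = exp (- integral {0..1} (\<lambda>x. \<bar>c \<bullet> (1, x)\<bar>))" for c
    using Z unfolding cauchy_stochastic_integral_def by blast+
  interpret prob_space M by fact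
  have prob: "prob_space ?\<mu>" by (rule prob_space_distr) simp
  have "vec_char ?\<mu> (- (s * t), s) = exp (- \<bar>s\<bar> * mean_dist t)" for s t
    unfolding char integral_abs_line by simp
  note fourier = plane_fourier_integral[OF borel_measurable_vec_char[OF prob] borel_measurable_mean_dist this mean_dist_pos integrable_inverse_mean_dist]
  have int: "integrable lborel (vec_char ?\<mu>)"
    by (rule fourier(1)) simp
  note inversion = vec_char_inversion[OF prob sets_distr int]
  have f_eq: "f = (\<lambda>x. Re (CLINT c|lborel. iexp (- (c \<bullet> x)) * vec_char ?\<mu> c) / (2 * pi) ^ DIM(real \<times> real))"
  proof
    fix x :: "real \<times> real"
    obtain x1 x2 where x: "x = (x1, x2)" by (cases x)
    show "f x = Re (CLINT c|lborel. iexp (- (c \<bullet> x)) * vec_char ?\<mu> c) / (2 * pi) ^ DIM(real \<times> real)"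
      unfolding x by (subst fourier(2)) (simp_all add: f_def power2_eq_square)
  qed
  have "continuous_on UNIV f" "\<And>x. 0 \<le> f x" "?\<mu> = density lborel (\<lambda>x. ennreal (f x))"
    unfolding f_eq by (fact inversion)+
  moreover have "distr M lborel Z = ?\<mu>"
    by (rule distr_cong) auto
  ultimately show ?thesis
    unfolding continuous_density_def distributed_def by (auto intro: borel_measurable_continuous_onI)
qed

theorem theorem4p2:
  fixes M :: "'w measure" and Z :: "'w \<Rightarrow> real \<times> real"
  assumes "prob_space M"
    and "cauchy_stochastic_integral M 0 1 (\<lambda>x. (1, x)) Z"
  shows "\<exists>f. continuous_density M Z f \<and>
    (\<forall>x1 x2 :: real. x1 \<noteq> 2 * x2 \<longrightarrow>
      (let Q = 1 - 2 * \<i> * complex_of_real x1 + (complex_of_real x1)^2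
                 + 4 * \<i> * complex_of_real x2
       in f (x1, x2) =
            (4 / pi^2) / (1 + 6 * x1^2 + x1^4 - 16 * x1 * x2 + 16 * x2^2)
            + 2 / pi^2 *
                Re (atan (\<i> * csqrt Q / complex_of_real (x1 - 2 * x2)) / Q powr (3/2)))) \<and>
    (\<forall>x1 x2 :: real. x1 = 2 * x2 \<longrightarrow>
      f (x1, x2) = (4 / pi^2) / (1 + x1^2)^2 + 1 / (pi * (1 + x1^2) powr (3/2)))"
proof -
  define f where "f = (\<lambda>(x1, x2). (LINT t|lborel. Re (1 / (mean_dist t + \<i> * of_real (t * x1 - x2))\<^sup>2)) / (2 * pi\<^sup>2))"
  have dens: "continuous_density M Z f"
    unfolding f_def using assms by (rule continuous_density_mean_dist)
  let ?Q = "\<lambda>x1 x2. 1 - 2 * \<i> * complex_of_real x1 + (complex_of_real x1)\<^sup>2 + 4 * \<i> * complex_of_real x2"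
  \<comment> \<open>The quartic denominator of the claim is the squared modulus of \<open>Q\<close>.
    Dividing the coefficients 8 and 4 of the line integral by \<open>2 * pi^2\<close> yields the
    prefactors \<open>4 / pi^2\<close> and \<open>2 / pi^2\<close>.\<close>
  have norm_Q: "(norm (?Q x1 x2))\<^sup>2 = 1 + 6 * x1^2 + x1^4 - 16 * x1 * x2 + 16 * x2^2" for x1 x2
    by (simp add: cmod_power2) (simp add: power2_eq_square power4_eq_xxxx algebra_simps)
  have nz: "?Q x1 x2 \<noteq> 0" for x1 x2
  proof -
    have "Re (?Q x1 x2) = 1 + x1\<^sup>2"
      by (simp add: power2_eq_square)
    then show ?thesis
      by (metis add_pos_nonneg less_irrefl zero_complex.sel(1) zero_le_power2 zero_less_one)
  qed
  have f_eq: "f (x1, x2) = (4 / pi^2) / (1 + 6 * x1^2 + x1^4 - 16 * x1 * x2 + 16 * x2^2)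
      + 2 / pi^2 * Re ((Arctan ((1 - \<i> * x1) / csqrt (?Q x1 x2)) - Arctan (- (1 + \<i> * x1) / csqrt (?Q x1 x2))) / ?Q x1 x2 powr (3 / 2))"
    for x1 x2
    unfolding f_def prod.case mean_dist_line_integral(1) csqrt_cubed[OF nz] norm_Q[symmetric]
    by (simp add: add_divide_distrib)
  show ?thesis
  proof (intro exI[of _ f] conjI allI impI dens)
    fix x1 x2 :: real
    assume neq: "x1 \<noteq> 2 * x2"
    show "let Q = ?Q x1 x2
       in f (x1, x2) =
            (4 / pi^2) / (1 + 6 * x1^2 + x1^4 - 16 * x1 * x2 + 16 * x2^2)
            + 2 / pi^2 *
                Re (atan (\<i> * csqrt Q / complex_of_real (x1 - 2 * x2)) / Q powr (3/2))"
      unfolding Let_def f_eq Arctan_diff_eq_atan(1)[OF neq] ..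
  next
    fix x1 x2 :: real
    assume eq: "x1 = 2 * x2"
    \<comment> \<open>On the exceptional line \<open>Q\<close> is real and positive, so the complex
      principal power reduces to the real one.\<close>
    have Q: "?Q x1 x2 = of_real (1 + x1\<^sup>2)"
      using eq by simp
    have "0 \<le> 1 + x1\<^sup>2" by simp
    then have "?Q x1 x2 powr (3 / 2) = of_real ((1 + x1\<^sup>2) powr (3 / 2))"
      unfolding Q using powr_of_real[of "1 + x1\<^sup>2" "3 / 2"] by simp
    then have "Re (of_real (pi / 2) / ?Q x1 x2 powr (3 / 2)) = pi / 2 / (1 + x1\<^sup>2) powr (3 / 2)"
      by (simp only: of_real_divide[symmetric] Re_complex_of_real)
    moreover have "1 + 6 * x1^2 + x1^4 - 16 * x1 * x2 + 16 * x2^2 = (1 + x1\<^sup>2)\<^sup>2"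
      unfolding eq by (simp add: power2_eq_square power4_eq_xxxx algebra_simps)
    ultimately have "f (x1, x2) = (4 / pi^2) / (1 + x1\<^sup>2)\<^sup>2 + 2 / pi^2 * (pi / 2 / (1 + x1\<^sup>2) powr (3 / 2))"
      unfolding f_eq by (simp only: Arctan_diff_eq_atan(2)[OF eq])
    also have "2 / pi^2 * (pi / 2 / (1 + x1\<^sup>2) powr (3 / 2)) = 1 / (pi * (1 + x1\<^sup>2) powr (3 / 2))"
      by (simp add: power2_eq_square)
    finally show "f (x1, x2) = (4 / pi^2) / (1 + x1^2)^2 + 1 / (pi * (1 + x1^2) powr (3/2))" .
  qed
qed

end
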